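(* Let $\mathcal{A}$ be a random set in $\mathcal{B}(n,\alpha)$ and $X := \deg \operatorname{lcm}\big([\mathcal{A}]_q\big)$, and let $\mathbb{V}[X]$ denote its variance. Then: (i) There exists a function $\mathrm{v} : (0,1) \to \mathbb{R}^+$ such that $\mathbb{V}[X] = (\mathrm{v}(\alpha) + o(1))\, n^3$ as $\alpha n / \big((\log n)^3 \log\log n\big) \to +\infty$; that is, for every $\varepsilon>0$ there exists $M>0$ such that for all integers $n\geq 3$ and all $\alpha\in(0,1)$ with $\alpha n/\big((\log n)^3\log\log n\big) \geq M$ one has $\big|\mathbb{V}[X]/n^3 - \mathrm{v}(\alpha)\big| \leq \varepsilon$. (ii) There is an absolute constant $C>0$ such that $\mathbb{V}[X] \leq C\,\alpha n^3$ for every positive integer $n$ and every $\alpha\in[0,1]$.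
   Context: For a positive integer $n$ and $\alpha\in[0,1]$, $\mathcal{B}(n,\alpha)$ denotes the probabilistic model in which a random set $\mathcal{A}\subseteq\{1,\dots,n\}$ is constructed by including each element of $\{1,\dots,n\}$ independently with probability $\alpha$. For an indeterminate $q$ and a positive integer $k$, $[k]_q := 1+q+\cdots+q^{k-1}\in\mathbb{Z}[q]$, and for a set $\mathcal{S}$ of positive integers $[\mathcal{S}]_q := \{[k]_q : k\in\mathcal{S}\}$. The least common multiple is taken in $\mathbb{Q}[q]$ (monic), with $\operatorname{lcm}(\varnothing)=1$ of degree $0$. *)

theory Defs
  imports Complex_Main "HOL-Computational_Algebra.Computational_Algebra" "HOL-Computational_Algebra.Field_as_Ring"
begin

definition qint :: "nat \<Rightarrow> rat poly" where
  "qint k = (\<Sum>i<k. monom 1 i)"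

text \<open>X(A) = deg lcm([A]_q); Lcm is the monic lcm in Q[q], Lcm {} = 1.\<close>
definition degLcm :: "nat set \<Rightarrow> nat" where
  "degLcm A = degree (Lcm (qint ` A))"

definition Bprob :: "nat \<Rightarrow> real \<Rightarrow> nat set \<Rightarrow> real" where
  "Bprob n \<alpha> A = \<alpha> ^ card A * (1 - \<alpha>) ^ (n - card A)"

definition EX_B :: "nat \<Rightarrow> real \<Rightarrow> real" where
  "EX_B n \<alpha> = (\<Sum>A\<in>Pow {1..n}. Bprob n \<alpha> A * real (degLcm A))"

definition VarX_B :: "nat \<Rightarrow> real \<Rightarrow> real" where
  "VarX_B n \<alpha> = (\<Sum>A\<in>Pow {1..n}. Bprob n \<alpha> A * (real (degLcm A) - EX_B n \<alpha>)^2)"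

end

theory Submission
  imports Defs "HOL-Analysis.Analysis" "HOL-Number_Theory.Totient"
begin

text \<open>
  Counting complex roots gives $X = \sum_d \varphi(d) I_d$, where $d \geq 2$ and $I_d$ indicates that
  some element of $A$ is a multiple of $d$. Hence, with $\beta = 1 - \alpha$, the variance is the sum over
  $d, e$ of $\varphi(d) \varphi(e)$ times the nonnegative covariance of $I_d$ and $I_e$. Write $d = ga$,
  $e = gb$ with $a, b$ coprime. For fixed $a, b$ the covariance depends on $g$ only through
  $m = \lfloor n/g \rfloor$, vanishes unless $gab \leq n$, and is at most $\alpha n/(gab)$. So the pair
  $(a, b)$ contributes at most $\alpha n^3/(ab)^2$, which gives (ii) and reduces (i) to finitely many
  pairs. For each of them, finitely many $m$ suffice, and the block of $g$ with
  $\lfloor n/g \rfloor = m$ is governed by the asymptotics of $\sum_{g \leq N} \varphi(ga) \varphi(gb)$, which is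
  a constant times $N^3$ because $\varphi(m)/m$ is a mean limit of periodic functions. All errors are uniform in
  $\alpha \in [0,1]$, so only $n \to \infty$ matters in (i). The limit is
  positive because the terms $d = e > n/2$ already contribute order $\alpha \beta n^3$.
\<close>

section \<open>The degree of the least common multiple\<close>

abbreviation cpoly :: "rat poly \<Rightarrow> complex poly" where
  "cpoly \<equiv> map_poly of_rat"

lemma cpoly_add: "cpoly (p + q) = cpoly p + cpoly q"
  by (rule poly_eqI) (simp add: coeff_map_poly of_rat_add)

lemma cpoly_mult: "cpoly (p * q) = cpoly p * cpoly q"
  by (rule poly_eqI) (simp add: coeff_map_poly coeff_mult of_rat_sum of_rat_mult)

lemma cpoly_pderiv: "cpoly (pderiv p) = pderiv (cpoly p)"
  by (rule poly_eqI) (simp add: coeff_map_poly coeff_pderiv of_rat_mult of_rat_add)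

lemma cpoly_dvd: "p dvd q \<Longrightarrow> cpoly p dvd cpoly q"
  by (auto simp: cpoly_mult elim!: dvdE)

lemma cpoly_prod: "cpoly (\<Prod>x\<in>A. f x) = (\<Prod>x\<in>A. cpoly (f x))"
  by (induction A rule: infinite_finite_induct) (simp_all add: cpoly_mult)

section \<open>Separable polynomials over the rationals\<close>

definition separable :: "rat poly \<Rightarrow> bool" where
  "separable p \<longleftrightarrow> coprime p (pderiv p)"

text \<open>A common divisor of \<open>p\<close> and \<open>pderiv p\<close>, or of \<open>p\<close>
  and \<open>q\<close>, divides both \<open>p * q\<close> and its derivative by the product rule, so
  it is a unit.\<close>

lemma separable_factors:
  assumes "separable (p * q)"
  shows "separable p" "coprime p q"
proof -
  have cop: "coprime (p * q) (p * pderiv q + q * pderiv p)"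
    using assms by (simp add: separable_def pderiv_mult)
  show "separable p"
    unfolding separable_def
  proof (rule coprimeI)
    fix c assume "c dvd p" "c dvd pderiv p"
    then show "is_unit c"
      using cop by (meson coprime_common_divisor dvd_add dvd_mult dvd_mult2)
  qed
  show "coprime p q"
  proof (rule coprimeI)
    fix c assume "c dvd p" "c dvd q"
    then show "is_unit c"
      using cop by (meson coprime_common_divisor dvd_add dvd_mult2)
  qed
qed

lemma separable_dvd: "separable q \<Longrightarrow> p dvd q \<Longrightarrow> separable p"
  using separable_factors(1) by (auto elim!: dvdE)

text \<open>Modulo \<open>p\<close> the derivative of the product reduces to
  \<open>q * pderiv p\<close>, both of whose factors are coprime to \<open>p\<close>; the same holds
  with \<open>p\<close> and \<open>q\<close> exchanged.\<close>

lemma separable_mult: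
  assumes "separable p" "separable q" "coprime p q"
  shows "separable (p * q)"
proof -
  have 1: "coprime p (q * pderiv p)"
    using assms by (simp add: separable_def)
  have 2: "coprime q (p * pderiv q)"
    using assms by (simp add: separable_def coprime_commute)
  have "gcd p (p * pderiv q + q * pderiv p) = gcd p (q * pderiv p)"
    by (metis gcd_add_mult add.commute mult.commute)
  moreover have "gcd q (p * pderiv q + q * pderiv p) = gcd q (p * pderiv q)"
    by (metis gcd_add_mult add.commute mult.commute)
  ultimately have "coprime p (p * pderiv q + q * pderiv p)"
    "coprime q (p * pderiv q + q * pderiv p)"
    using 1 2 by (simp_all only: coprime_iff_gcd_eq_1)
  then show ?thesis
    by (simp add: separable_def pderiv_mult)
qed

text \<open>After division by the gcd \<open>g\<close>, the cofactor \<open>p'\<close> is coprime to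
  \<open>q'\<close>, and to \<open>g\<close> because \<open>p = g * p'\<close> is separable. Hence
  \<open>p' * q\<close> is separable, and the lcm divides it.\<close>

lemma separable_lcm:
  assumes "separable p" "separable q"
  shows "separable (lcm p q)"
proof (cases "p = 0 \<or> q = 0")
  \<comment> \<open>Zero is not separable, so this case contradicts the hypotheses.\<close>
  case True
  then show ?thesis using assms by (auto simp: separable_def)
next
  case False
  define g where "g = gcd p q"
  obtain p' where p': "p = g * p'" unfolding g_def by (meson dvdE gcd_dvd1)
  obtain q' where q': "q = g * q'" unfolding g_def by (meson dvdE gcd_dvd2)
  have g0: "g \<noteq> 0" using False by (simp add: g_def)
  have "coprime p' q'"
    using g0 False g_def p' q' by (metis coprimeI dvd_mult_cancel_left gcd_greatest mult_dvd_mono dvd_refl dvd_triv_left mult_1_right)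
  moreover have "coprime p' g"
    using separable_factors(2)[of g p'] assms p' by (simp add: coprime_commute)
  moreover have "separable p'"
    using separable_dvd[OF assms(1)] p' by simp
  ultimately have "separable (p' * q)"
    using assms(2) by (intro separable_mult) (simp_all add: q')
  moreover have "lcm p q dvd p' * q"
    by (rule lcm_least) (simp_all add: p' q' mult_ac)
  ultimately show ?thesis by (rule separable_dvd)
qed

lemma separable_Lcm:
  assumes "finite A" "\<And>p. p \<in> A \<Longrightarrow> separable p"
  shows "separable (Lcm A)"
  using assms by (induction A rule: finite_induct) (simp_all add: separable_lcm, simp add: separable_def)

text \<open>A Bezout identity over the rationals remains valid over the complex numbers, so
  \<open>p\<close> and its derivative have no common complex root. All roots are then simple, and
  the splitting into linear factors gives the degree.\<close>

lemma degree_separable: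
  assumes "separable p"
  shows "degree p = card {z. poly (cpoly p) z = 0}"
proof -
  from assms obtain u v where "u * p + v * pderiv p = 1"
    unfolding separable_def coprime_iff_gcd_eq_1 by (metis bezout_coefficients_fst_snd)
  then have "cpoly (u * p + v * pderiv p) = 1" by simp
  then have "cpoly u * cpoly p + cpoly v * pderiv (cpoly p) = 1"
    by (simp only: cpoly_add cpoly_mult cpoly_pderiv)
  then have "poly (cpoly u) z * poly (cpoly p) z + poly (cpoly v) z * poly (pderiv (cpoly p)) z = 1" for z
    by (metis poly_1 poly_add poly_mult)
  then have "rsquarefree (cpoly p)"
    unfolding rsquarefree_roots by (metis add_0 mult_zero_right zero_neq_one)
  then have dec: "smult (lead_coeff (cpoly p)) (\<Prod>z | poly (cpoly p) z = 0. [:-z, 1:]) = cpoly p"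
    by (rule complex_poly_decompose_rsquarefree)
  have nz: "cpoly p \<noteq> 0"
    using \<open>rsquarefree (cpoly p)\<close> by (simp add: rsquarefree_def)
  have "degree p = degree (cpoly p)"
    by (rule degree_map_poly [symmetric]) simp
  also have "\<dots> = degree (\<Prod>z | poly (cpoly p) z = 0. [:-z, 1:])"
    by (subst dec [symmetric]) (use nz in simp)
  also have "\<dots> = card {z. poly (cpoly p) z = 0}"
    by (subst degree_prod_eq_sum_degree) auto
  finally show ?thesis .
qed

lemma poly_cpoly_qint: "poly (cpoly (qint k)) z = (\<Sum>i<k. z ^ i)"
proof -
  have "cpoly (qint k) = (\<Sum>i<k. monom 1 i)"
    by (induction k) (simp_all add: qint_def cpoly_add map_poly_monom)
  then show ?thesis by (simp add: poly_sum poly_monom)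
qed

lemma qint_root_iff: "k > 0 \<Longrightarrow> poly (cpoly (qint k)) z = 0 \<longleftrightarrow> z \<noteq> 1 \<and> z ^ k = 1"
  by (cases "z = 1") (simp_all add: poly_cpoly_qint geometric_sum)

lemma qint_times: "qint k * (monom 1 1 - 1) = monom 1 k - 1"
proof (induction k)
  case (Suc k)
  have "qint (Suc k) * (monom 1 1 - 1) = qint k * (monom 1 1 - 1) + monom 1 k * (monom 1 1 - 1)"
    by (simp add: qint_def distrib_right)
  also have "\<dots> = monom 1 (Suc k) - 1"
    unfolding Suc by (simp add: mult_monom right_diff_distrib)
  finally show ?case .
qed (simp add: qint_def)

text \<open>\<open>qint k\<close> divides x^k - 1. A common divisor of x^k - 1 and its derivative k
  x^(k-1) divides x^k as well, hence also 1.\<close>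

lemma separable_qint:
  assumes "k > 0"
  shows "separable (qint k)"
proof -
  have "separable (monom 1 k - 1)"
    unfolding separable_def
  proof (rule coprimeI)
    fix c :: "rat poly" assume c: "c dvd monom 1 k - 1" "c dvd pderiv (monom 1 k - 1)"
    have "pderiv (monom (1::rat) k - 1) = monom (of_nat k) (k - 1)"
      by (simp add: pderiv_diff pderiv_monom)
    then have "c dvd monom (of_nat k) (k - 1) * monom (1 / of_nat k) 1"
      using c by (metis dvd_mult2)
    also have "monom (of_nat k) (k - 1) * monom (1 / of_nat k) 1 = monom (1::rat) k"
      using assms by (simp add: mult_monom)
    finally have "c dvd monom 1 k - (monom 1 k - 1)"
      using c(1) by (meson dvd_diff)
    then show "is_unit c" by simp
  qed
  then show ?thesis
    using qint_times by (metis separable_factors(1))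
qed

text \<open>The Lcm is a multiple of each \<open>qint k\<close> and divides their product, so its
  roots are exactly the union of their roots; separability turns the degree into a root
  count.\<close>

lemma degLcm_eq_card_roots:
  assumes "finite A" "0 \<notin> A"
  shows "degLcm A = card {z::complex. z \<noteq> 1 \<and> (\<exists>k\<in>A. z ^ k = 1)}"
proof -
  have pos: "k > 0" if "k \<in> A" for k using that assms by (cases k) auto
  define L where "L = Lcm (qint ` A)"
  have "separable L"
    unfolding L_def by (rule separable_Lcm) (use assms pos separable_qint in auto)
  then have "degLcm A = card {z. poly (cpoly L) z = 0}"
    by (simp add: degLcm_def degree_separable flip: L_def)
  also have "{z. poly (cpoly L) z = 0} = {z. \<exists>k\<in>A. poly (cpoly (qint k)) z = 0}"
  proof (intro subset_antisym subsetI; clarify)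
    fix z assume z: "poly (cpoly L) z = 0"
    have "L dvd (\<Prod>k\<in>A. qint k)"
      unfolding L_def using assms by (intro Lcm_least) (auto intro: dvd_prodI)
    then have "cpoly L dvd (\<Prod>k\<in>A. cpoly (qint k))"
      using cpoly_dvd cpoly_prod by metis
    then have "poly (\<Prod>k\<in>A. cpoly (qint k)) z = 0"
      using z by (auto elim!: dvdE)
    then show "\<exists>k\<in>A. poly (cpoly (qint k)) z = 0"
      using assms by (simp add: poly_prod)
  next
    fix z k assume "k \<in> A" "poly (cpoly (qint k)) z = 0"
    moreover from this have "cpoly (qint k) dvd cpoly L"
      unfolding L_def by (intro cpoly_dvd dvd_Lcm) auto
    ultimately show "poly (cpoly L) z = 0" by (auto elim!: dvdE)
  qed
  also have "\<dots> = {z. z \<noteq> 1 \<and> (\<exists>k\<in>A. z ^ k = 1)}"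
    using pos qint_root_iff by blast
  finally show ?thesis .
qed

section \<open>Roots of unity of exact order d\<close>

definition prim_roots :: "nat \<Rightarrow> complex set" where
  "prim_roots d = {z. z ^ d = 1 \<and> (\<forall>j\<in>{1..<d}. z ^ j \<noteq> 1)}"

text \<open>Division with remainder replaces \<open>k\<close> by \<open>k mod d\<close>, and
  minimality of \<open>d\<close> forces this remainder to be 0. As defined,
  \<open>prim_roots 0\<close> is the whole complex plane, hence the assumption
  \<open>d > 0\<close>.\<close>

lemma prim_roots_power_iff:
  assumes "z \<in> prim_roots d" "d > 0"
  shows "z ^ k = 1 \<longleftrightarrow> d dvd k"
proof
  assume "z ^ k = 1"
  have "z ^ k = (z ^ d) ^ (k div d) * z ^ (k mod d)"
    by (simp flip: power_mult power_add)
  then have "z ^ (k mod d) = 1"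
    using assms \<open>z ^ k = 1\<close> by (simp add: prim_roots_def)
  moreover have "k mod d < d" using assms by simp
  ultimately have "k mod d = 0"
    using assms(1) by (force simp: prim_roots_def)
  then show "d dvd k" by auto
next
  assume "d dvd k"
  then show "z ^ k = 1" using assms by (auto simp: prim_roots_def power_mult elim!: dvdE)
qed

lemma ex_prim_roots:
  assumes "z ^ k = 1" "k > 0"
  obtains d where "d > 0" "z \<in> prim_roots d"
proof -
  define d where "d = (LEAST j. j > 0 \<and> z ^ j = 1)"
  have "d > 0 \<and> z ^ d = 1"
    unfolding d_def by (rule LeastI[of _ k]) (use assms in auto)
  moreover have "z ^ j \<noteq> 1" if "j \<in> {1..<d}" for j
    using not_less_Least[of j "\<lambda>j. j > 0 \<and> z ^ j = 1"] that by (auto simp: d_def)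
  ultimately show ?thesis using that by (auto simp: prim_roots_def)
qed

lemma prim_roots_disjoint:
  assumes "z \<in> prim_roots d" "z \<in> prim_roots e" "d > 0" "e > 0"
  shows "d = e"
  using assms prim_roots_power_iff dvd_antisym dvd_refl by metis

lemma finite_prim_roots: "d > 0 \<Longrightarrow> finite (prim_roots d)"
  by (rule finite_subset[of _ "{z. z ^ d = 1}"]) (auto simp: prim_roots_def intro!: finite_roots_unity)

text \<open>Splitting the \<open>d\<close> roots of z^d = 1 by exact order shows that both sides
  have the same sum over the divisors of \<open>d\<close>. By strong induction the proper divisors
  cancel.\<close>

lemma card_prim_roots: "d > 0 \<Longrightarrow> card (prim_roots d) = totient d"
proof (induction d rule: less_induct)
  case (less d)
  have "{z::complex. z ^ d = 1} = (\<Union>e\<in>{e. e dvd d}. prim_roots e)"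
  proof (intro subset_antisym subsetI)
    fix z :: complex assume "z \<in> {z. z ^ d = 1}"
    then have "z ^ d = 1" by simp
    then obtain e where "e > 0" "z \<in> prim_roots e" using less.prems by (rule ex_prim_roots)
    with \<open>z ^ d = 1\<close> show "z \<in> (\<Union>e\<in>{e. e dvd d}. prim_roots e)" 
      using prim_roots_power_iff by blast
  qed (use less.prems in \<open>auto simp: prim_roots_def power_mult elim!: dvdE\<close>)
  moreover have "card {z::complex. z ^ d = 1} = d"
    using less.prems by (simp add: card_roots_unity_eq)
  moreover have "card (\<Union>e\<in>{e. e dvd d}. prim_roots e) = (\<Sum>e\<in>{e. e dvd d}. card (prim_roots e))"
  proof (intro card_UN_disjoint ballI impI)
    fix a b assume "a \<in> {e. e dvd d}" "b \<in> {e. e dvd d}" "a \<noteq> b"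
    then show "prim_roots a \<inter> prim_roots b = {}"
      using prim_roots_disjoint[of _ a b] dvd_pos_nat[OF less.prems] by auto
  qed (use less.prems dvd_pos_nat in \<open>auto intro!: finite_prim_roots\<close>)
  ultimately have "(\<Sum>e\<in>{e. e dvd d}. card (prim_roots e)) = (\<Sum>e\<in>{e. e dvd d}. totient e)"
    by (simp add: totient_divisor_sum)
  moreover have "{e. e dvd d} = insert d {e. e dvd d \<and> e < d}"
    using less.prems by (auto dest: dvd_imp_le)
  moreover have "(\<Sum>e\<in>{e. e dvd d \<and> e < d}. card (prim_roots e)) = (\<Sum>e\<in>{e. e dvd d \<and> e < d}. totient e)"
    using less dvd_pos_nat by (intro sum.cong) auto
  ultimately show ?case by simp
qed

text \<open>A root of unity of exact order \<open>d\<close> is counted iff \<open>d\<close> divides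
  some element of \<open>A\<close>, so the roots are grouped by order. The range starts at 2 because
  order 1 belongs to the excluded point 1, and ends at \<open>n\<close> because \<open>d\<close>
  divides some k \<le> n.\<close>

lemma degLcm_eq_sum_totient:
  assumes "A \<subseteq> {1..n}"
  shows "degLcm A = (\<Sum>d\<in>{2..n}. if \<exists>k\<in>A. d dvd k then totient d else 0)"
proof -
  have fin: "finite A" using assms by (rule finite_subset) simp
  have pos: "k > 0" "k \<le> n" if "k \<in> A" for k using that assms by auto
  define D where "D = {d\<in>{2..n}. \<exists>k\<in>A. d dvd k}"
  have "{z::complex. z \<noteq> 1 \<and> (\<exists>k\<in>A. z ^ k = 1)} = (\<Union>d\<in>D. prim_roots d)"
  proof (intro subset_antisym subsetI)
    fix z :: complex assume "z \<in> {z. z \<noteq> 1 \<and> (\<exists>k\<in>A. z ^ k = 1)}"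
    then obtain k where k: "z \<noteq> 1" "k \<in> A" "z ^ k = 1" by auto
    then obtain d where d: "d > 0" "z \<in> prim_roots d" using ex_prim_roots pos by metis
    then have "d dvd k" using k prim_roots_power_iff by metis
    then have "d \<le> n" using pos[OF k(2)] by (meson dvd_imp_le le_trans)
    moreover have "d \<noteq> 1" using k(1) d by (auto simp: prim_roots_def)
    ultimately have "d \<in> D" using d \<open>d dvd k\<close> k(2) by (auto simp: D_def)
    then show "z \<in> (\<Union>d\<in>D. prim_roots d)" using d by blast
  next
    fix z assume "z \<in> (\<Union>d\<in>D. prim_roots d)"
    then obtain d k where d: "z \<in> prim_roots d" "d \<ge> 2" "k \<in> A" "d dvd k" by (auto simp: D_def)
    then have "z ^ k = 1" "z \<noteq> 1"
      using prim_roots_power_iff[of z d k] prim_roots_power_iff[of z d 1] by auto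
    then show "z \<in> {z. z \<noteq> 1 \<and> (\<exists>k\<in>A. z ^ k = 1)}" using d by auto
  qed
  then have "degLcm A = card (\<Union>d\<in>D. prim_roots d)"
    using degLcm_eq_card_roots[OF fin] pos by auto
  also have "\<dots> = (\<Sum>d\<in>D. card (prim_roots d))"
  proof (intro card_UN_disjoint ballI impI)
    fix d e assume "d \<in> D" "e \<in> D" "d \<noteq> e"
    then show "prim_roots d \<inter> prim_roots e = {}"
      using prim_roots_disjoint[of _ d e] by (auto simp: D_def)
  qed (auto simp: D_def intro!: finite_prim_roots)
  also have "\<dots> = (\<Sum>d\<in>D. totient d)"
    by (intro sum.cong) (auto simp: D_def card_prim_roots)
  finally show ?thesis by (simp only: D_def sum.inter_filter finite_atLeastAtMost)
qed

section \<open>The variance as a double sum\<close>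

lemma sum_Pow_power_card:
  fixes x y :: "'a :: comm_semiring_1"
  assumes "finite T"
  shows "(\<Sum>A\<in>Pow T. x ^ card A * y ^ (card T - card A)) = (x + y) ^ card T"
proof -
  have "(x + y) ^ card T = (\<Prod>t\<in>T. x + y)" by simp
  also have "\<dots> = (\<Sum>A\<in>Pow T. (\<Prod>t\<in>A. x) * (\<Prod>t\<in>T - A. y))"
    using assms by (rule prod_add)
  also have "\<dots> = (\<Sum>A\<in>Pow T. x ^ card A * y ^ (card T - card A))"
    using assms by (intro sum.cong) (auto simp: card_Diff_subset finite_subset)
  finally show ?thesis by simp
qed

text \<open>The sets avoiding \<open>S\<close> are the subsets of its complement \<open>T\<close>.
  The factor for the elements of \<open>S\<close> splits off, and what remains is the total mass of
  the model on \<open>T\<close>, which is 1.\<close>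

lemma sum_Bprob_disjoint:
  assumes "S \<subseteq> {1..n}"
  shows "(\<Sum>A\<in>Pow {1..n}. Bprob n \<alpha> A * of_bool (A \<inter> S = {})) = (1 - \<alpha>) ^ card S"
proof -
  define T where "T = {1..n} - S"
  have fin: "finite S" "finite T" using assms finite_subset by (auto simp: T_def)
  have card_T: "card T = n - card S" "card S \<le> n"
    using assms fin card_mono[OF _ assms] by (auto simp: T_def card_Diff_subset)
  have "(\<Sum>A\<in>Pow {1..n}. Bprob n \<alpha> A * of_bool (A \<inter> S = {})) = (\<Sum>A\<in>Pow T. Bprob n \<alpha> A)"
    by (rule sum.mono_neutral_cong_right) (auto simp: T_def)
  also have "\<dots> = (\<Sum>A\<in>Pow T. (1 - \<alpha>) ^ card S * (\<alpha> ^ card A * (1 - \<alpha>) ^ (card T - card A)))"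
  proof (rule sum.cong)
    fix A assume "A \<in> Pow T"
    then have "card A \<le> card T" using fin by (simp add: card_mono)
    then have "n - card A = card S + (card T - card A)" using card_T by simp
    then show "Bprob n \<alpha> A = (1 - \<alpha>) ^ card S * (\<alpha> ^ card A * (1 - \<alpha>) ^ (card T - card A))"
      by (simp add: Bprob_def power_add)
  qed simp
  also have "\<dots> = (1 - \<alpha>) ^ card S"
    using fin by (simp add: sum_Pow_power_card flip: sum_distrib_left)
  finally show ?thesis .
qed

definition mults :: "nat \<Rightarrow> nat \<Rightarrow> nat set" where
  "mults n d = {k\<in>{1..n}. d dvd k}"

lemma mults_subset: "mults n d \<subseteq> {1..n}" and finite_mults [simp]: "finite (mults n d)"
  by (auto simp: mults_def)

lemma mults_conv_image: "d > 0 \<Longrightarrow> mults n d = (\<lambda>k. d * k) ` {1..n div d}"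
proof (intro subset_antisym subsetI)
  fix x assume "d > 0" "x \<in> mults n d"
  then obtain k where "x = d * k" "1 \<le> x" "x \<le> n" by (auto simp: mults_def)
  then have "k \<in> {1..n div d}" using \<open>d > 0\<close> by (auto simp: less_eq_div_iff_mult_less_eq mult.commute)
  then show "x \<in> (\<lambda>k. d * k) ` {1..n div d}" using \<open>x = d * k\<close> by blast
qed (auto simp: mults_def less_eq_div_iff_mult_less_eq mult.commute)

lemma card_mults: "d > 0 \<Longrightarrow> card (mults n d) = n div d"
  by (simp add: mults_conv_image card_image inj_on_def)

lemma card_mults_Un:
  assumes "d > 0" "e > 0"
  shows "card (mults n d \<union> mults n e) = n div d + n div e - n div lcm d e"
proof -
  have "mults n d \<inter> mults n e = mults n (lcm d e)" by (auto simp: mults_def)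
  then show ?thesis
    using card_Un_Int[of "mults n d" "mults n e"] assms by (simp add: card_mults lcm_pos_nat)
qed

lemma degLcm_eq_sum_of_bool:
  assumes "A \<subseteq> {1..n}"
  shows "real (degLcm A) = (\<Sum>d\<in>{2..n}. real (totient d) * (1 - of_bool (A \<inter> mults n d = {})))"
proof -
  have "(\<exists>k\<in>A. d dvd k) \<longleftrightarrow> A \<inter> mults n d \<noteq> {}" for d
    using assms unfolding mults_def by blast
  then show ?thesis
    unfolding degLcm_eq_sum_totient[OF assms] of_nat_sum by (intro sum.cong) auto
qed

text \<open>With \<beta> = 1 - \<alpha> this is the covariance of the events that \<open>A\<close>
  misses all multiples of \<open>d\<close>, respectively of \<open>e\<close>; passing to complements
  leaves it unchanged. For positive \<open>d\<close> and \<open>e\<close> the first exponent is the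
  size of the union of the two sets of multiples, so the natural subtraction is exact.\<close>

definition cov :: "real \<Rightarrow> nat \<Rightarrow> nat \<Rightarrow> nat \<Rightarrow> real" where
  "cov \<beta> n d e = \<beta> ^ (n div d + n div e - n div lcm d e) - \<beta> ^ (n div d + n div e)"

text \<open>Linearity of expectation writes the centred variable as a weighted sum of
  \<open>p d - J d\<close>, where \<open>J d\<close> indicates that \<open>A\<close> misses the
  multiples of \<open>d\<close> and \<open>p d\<close> is its mean. Squaring and averaging leaves
  E(J_d J_e) - p_d p_e.\<close>

lemma VarX_B_eq:
  "VarX_B n \<alpha> = (\<Sum>d\<in>{2..n}. \<Sum>e\<in>{2..n}. real (totient d) * real (totient e) * cov (1 - \<alpha>) n d e)"
proof -
  define J :: "nat \<Rightarrow> nat set \<Rightarrow> real" where "J d A = of_bool (A \<inter> mults n d = {})" for d A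
  define p where "p d = (1 - \<alpha>) ^ (n div d)" for d
  let ?E = "\<lambda>f. \<Sum>A\<in>Pow {1..n}. Bprob n \<alpha> A * f A"
  have E1: "?E (\<lambda>A. 1) = 1"
    using sum_Bprob_disjoint[of "{}" n \<alpha>] by simp
  have EJ: "?E (J d) = p d" if "d > 0" for d
    using sum_Bprob_disjoint[OF mults_subset, of n \<alpha> d] that
    by (simp add: J_def p_def card_mults)
  have EJJ: "?E (\<lambda>A. J d A * J e A) = (1 - \<alpha>) ^ (n div d + n div e - n div lcm d e)"
    if "d > 0" "e > 0" for d e
  proof -
    have "J d A * J e A = of_bool (A \<inter> (mults n d \<union> mults n e) = {})" for A
      by (auto simp: J_def Int_Un_distrib)
    then show ?thesis
      using sum_Bprob_disjoint[of "mults n d \<union> mults n e" n \<alpha>] mults_subset that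
      by (simp add: card_mults_Un)
  qed
  have X: "real (degLcm A) = (\<Sum>d\<in>{2..n}. real (totient d) * (1 - J d A))" if "A \<in> Pow {1..n}" for A
    using that degLcm_eq_sum_of_bool unfolding J_def by blast
  have EX: "EX_B n \<alpha> = (\<Sum>d\<in>{2..n}. real (totient d) * (1 - p d))"
  proof -
    have "EX_B n \<alpha> = ?E (\<lambda>A. \<Sum>d\<in>{2..n}. real (totient d) * (1 - J d A))"
      unfolding EX_B_def by (intro sum.cong refl) (simp add: X)
    also have "\<dots> = (\<Sum>d\<in>{2..n}. ?E (\<lambda>A. real (totient d) * (1 - J d A)))"
      unfolding sum_distrib_left by (rule sum.swap)
    also have "\<dots> = (\<Sum>d\<in>{2..n}. real (totient d) * (?E (\<lambda>A. 1) - ?E (J d)))"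
      by (simp add: sum_distrib_left algebra_simps flip: sum_subtractf)
    also have "\<dots> = (\<Sum>d\<in>{2..n}. real (totient d) * (1 - p d))"
      unfolding E1 by (intro sum.cong) (simp_all add: EJ del: One_nat_def)
    finally show ?thesis .
  qed
  have sq: "(real (degLcm A) - EX_B n \<alpha>)\<^sup>2
      = (\<Sum>d\<in>{2..n}. \<Sum>e\<in>{2..n}. real (totient d) * real (totient e) * ((p d - J d A) * (p e - J e A)))"
    if "A \<in> Pow {1..n}" for A
  proof -
    have "real (degLcm A) - EX_B n \<alpha> = (\<Sum>d\<in>{2..n}. real (totient d) * (p d - J d A))"
      unfolding EX X[OF that] sum_subtractf [symmetric] by (intro sum.cong) (simp_all add: algebra_simps)
    then show ?thesis
      by (simp add: power2_eq_square sum_product mult_ac)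
  qed
  have "VarX_B n \<alpha> = ?E (\<lambda>A. \<Sum>d\<in>{2..n}. \<Sum>e\<in>{2..n}.
      real (totient d) * real (totient e) * ((p d - J d A) * (p e - J e A)))"
    unfolding VarX_B_def by (intro sum.cong refl) (simp add: sq)
  also have "\<dots> = (\<Sum>d\<in>{2..n}. \<Sum>e\<in>{2..n}. ?E (\<lambda>A.
      real (totient d) * real (totient e) * ((p d - J d A) * (p e - J e A))))"
    unfolding sum_distrib_left
    by (subst sum.swap, rule sum.cong[OF refl], rule sum.swap)
  also have "\<dots> = (\<Sum>d\<in>{2..n}. \<Sum>e\<in>{2..n}. real (totient d) * real (totient e) *
      (p d * p e * ?E (\<lambda>A. 1) - p d * ?E (J e) - p e * ?E (J d) + ?E (\<lambda>A. J d A * J e A)))"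
    by (simp add: sum_distrib_left algebra_simps flip: sum_subtractf sum.distrib)
  also have "\<dots> = (\<Sum>d\<in>{2..n}. \<Sum>e\<in>{2..n}. real (totient d) * real (totient e) * cov (1 - \<alpha>) n d e)"
    unfolding E1 by (intro sum.cong refl) (simp add: EJ EJJ cov_def p_def power_add del: One_nat_def)
  finally show ?thesis .
qed

section \<open>Mean values of totient products\<close>

text \<open>A three-term triangle inequality shows that \<open>f\<close> is uniformly Cauchy. This
  criterion makes it possible to prove convergence later without identifying any limit.\<close>

lemma uniformly_convergent_on_approx:
  fixes f :: "nat \<Rightarrow> 'a \<Rightarrow> real"
  assumes approx: "\<And>e. e > 0 \<Longrightarrow> \<exists>g. uniformly_convergent_on X g \<and>
                     (\<forall>\<^sub>F n in sequentially. \<forall>x\<in>X. \<bar>f n x - g n x\<bar> \<le> e)"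
  shows "uniformly_convergent_on X f"
proof (rule Cauchy_uniformly_convergent, rule uniformly_Cauchy_onI)
  fix e :: real assume "e > 0"
  then obtain g N where g: "uniformly_convergent_on X g"
    and N: "\<And>n x. n \<ge> N \<Longrightarrow> x \<in> X \<Longrightarrow> \<bar>f n x - g n x\<bar> \<le> e / 4"
    using approx[of "e / 4"] by (auto simp: eventually_sequentially)
  obtain M where M: "\<And>x m n. x \<in> X \<Longrightarrow> m \<ge> M \<Longrightarrow> n \<ge> M \<Longrightarrow> dist (g m x) (g n x) < e / 4"
    using uniformly_convergent_Cauchy[OF g] \<open>e > 0\<close> unfolding uniformly_Cauchy_on_def
    by (metis divide_pos_pos zero_less_numeral)
  have "dist (f m x) (f n x) < e" if "x \<in> X" "m \<ge> max M N" "n \<ge> max M N" for x m n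
  proof -
    have "\<bar>f m x - g m x\<bar> \<le> e / 4" "\<bar>f n x - g n x\<bar> \<le> e / 4" "\<bar>g m x - g n x\<bar> < e / 4"
      using N[of m x] N[of n x] M[of x m n] that by (auto simp: dist_real_def)
    then show ?thesis using \<open>e > 0\<close> unfolding dist_real_def by linarith
  qed
  then show "\<exists>M. \<forall>x\<in>X. \<forall>m\<ge>M. \<forall>n\<ge>M. dist (f m x) (f n x) < e" by blast
qed

lemma convergent_approx:
  fixes f :: "nat \<Rightarrow> real"
  assumes "\<And>e. e > 0 \<Longrightarrow> \<exists>g. convergent g \<and> (\<forall>\<^sub>F n in sequentially. \<bar>f n - g n\<bar> \<le> e)"
  shows "convergent f"
proof -
  have "uniformly_convergent_on {()} (\<lambda>n _. f n)"
  proof (rule uniformly_convergent_on_approx)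
    fix e :: real assume "e > 0"
    then obtain g where "convergent g" "\<forall>\<^sub>F n in sequentially. \<bar>f n - g n\<bar> \<le> e"
      using assms by blast
    then show "\<exists>h. uniformly_convergent_on {()} h \<and>
        (\<forall>\<^sub>F n in sequentially. \<forall>x\<in>{()}. \<bar>f n - h n x\<bar> \<le> e)"
      by (intro exI[of _ "\<lambda>n _. g n"]) (simp add: uniformly_convergent_on_singleton)
  qed
  then show ?thesis by (simp add: uniformly_convergent_on_singleton)
qed

lemma uniformly_convergent_on_sum_finite:
  fixes f :: "'i \<Rightarrow> nat \<Rightarrow> 'a \<Rightarrow> real"
  assumes "\<And>i. i \<in> I \<Longrightarrow> uniformly_convergent_on X (f i)"
  shows "uniformly_convergent_on X (\<lambda>n x. \<Sum>i\<in>I. f i n x)"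
  using assms by (induction I rule: infinite_finite_induct) (auto intro!: uniformly_convergent_add)

text \<open>Used with \<open>h\<close> a covariance depending on \<alpha> only and \<open>c\<close>
  a totient sum depending on \<open>n\<close> only: the rate of convergence of \<open>c\<close> then
  serves for all \<alpha> at once.\<close>

lemma uniformly_convergent_on_bounded_mult:
  fixes c :: "nat \<Rightarrow> real"
  assumes "convergent c" and h: "\<And>x. x \<in> X \<Longrightarrow> \<bar>h x\<bar> \<le> 1"
  shows "uniformly_convergent_on X (\<lambda>n x. h x * c n)"
proof -
  obtain L where L: "c \<longlonglongrightarrow> L" using assms(1) by (auto simp: convergent_def)
  have "uniform_limit X (\<lambda>n x. h x * c n) (\<lambda>x. h x * L) sequentially"
    unfolding uniform_limit_iff
  proof (intro allI impI)
    fix e :: real assume "e > 0"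
    with L have "\<forall>\<^sub>F n in sequentially. dist (c n) L < e" by (rule tendstoD)
    then show "\<forall>\<^sub>F n in sequentially. \<forall>x\<in>X. dist (h x * c n) (h x * L) < e"
    proof eventually_elim
      case (elim n)
      show ?case
      proof
        fix x assume "x \<in> X"
        have "dist (h x * c n) (h x * L) = \<bar>h x\<bar> * dist (c n) L"
          by (simp add: dist_real_def abs_mult flip: right_diff_distrib)
        also have "\<dots> \<le> 1 * dist (c n) L" using h[OF \<open>x \<in> X\<close>] by (intro mult_right_mono) auto
        finally show "dist (h x * c n) (h x * L) < e" using elim by simp
      qed
    qed
  qed
  then show ?thesis by (rule uniformly_convergentI)
qed

section \<open>Weighted means over the multiples of a fixed number\<close>

lemma div_over_tendsto:
  assumes "d > 0"
  shows "(\<lambda>N. real (N div d) / real N) \<longlonglongrightarrow> 1 / real d"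
proof (rule real_tendsto_sandwich)
  show "\<forall>\<^sub>F N in sequentially. 1 / real d - 1 / real N \<le> real (N div d) / real N"
    using eventually_gt_at_top[of 0]
  proof eventually_elim
    case (elim N)
    have "real N / real d < real (N div d) + 1"
      using floor_divide_of_nat_eq[of N d, where ?'a = real] by linarith
    then have "(real N / real d - 1) / real N \<le> real (N div d) / real N"
      by (intro divide_right_mono) auto
    then show ?case using elim by (simp add: diff_divide_distrib)
  qed
  show "\<forall>\<^sub>F N in sequentially. real (N div d) / real N \<le> 1 / real d"
    using eventually_gt_at_top[of 0]
  proof eventually_elim
    case (elim N)
    have "real (N div d) / real N \<le> (real N / real d) / real N"
      by (intro divide_right_mono of_nat_div_le_of_nat) auto
    then show ?case using elim by simp
  qed
  have "(\<lambda>N. 1 / real d - 1 / real N) \<longlonglongrightarrow> 1 / real d - 0"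
    by (intro tendsto_intros lim_1_over_n)
  then show "(\<lambda>N. 1 / real d - 1 / real N) \<longlonglongrightarrow> 1 / real d" by simp
qed simp

lemma sum_squares: "(\<Sum>k\<in>{1..n}. (real k)\<^sup>2) = real n * (real n + 1) * (2 * real n + 1) / 6"
  by (induction n) (simp_all add: power2_eq_square field_simps)

text \<open>Quantifying over all \<open>d\<close> makes the property stable under multiplication of \<open>u\<close>
  by the factors \<open>1 - [e | g] / c\<close>.\<close>

definition has_means :: "(nat \<Rightarrow> real) \<Rightarrow> bool" where
  "has_means u \<longleftrightarrow> (\<forall>d>0. convergent (\<lambda>N. (\<Sum>g\<in>mults N d. (real g)\<^sup>2 * u g) / real N ^ 3))"

text \<open>Writing g = d k turns the sum into d^2 times a sum of squares up to
  \<open>N div d\<close>, a cubic polynomial in \<open>N div d\<close>; after division by N^3 only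
  the limit 1/d of \<open>q N\<close> matters.\<close>

lemma has_means_1: "has_means (\<lambda>_. 1)"
  unfolding has_means_def
proof (intro allI impI)
  fix d :: nat assume "d > 0"
  define q where "q N = real (N div d) / real N" for N
  have eq: "(\<Sum>g\<in>mults N d. (real g)\<^sup>2 * 1) / real N ^ 3
      = (real d)\<^sup>2 / 6 * (q N * (q N + 1 / real N) * (2 * q N + 1 / real N))" for N
  proof (cases "N = 0")
    case False
    have "(\<Sum>g\<in>mults N d. (real g)\<^sup>2 * 1) = (real d)\<^sup>2 * (\<Sum>k\<in>{1..N div d}. (real k)\<^sup>2)"
      using \<open>d > 0\<close>
      by (simp add: mults_conv_image sum.reindex inj_on_def sum_distrib_left power_mult_distrib)
    then show ?thesis
      using False unfolding sum_squares q_def by (simp add: field_simps power3_eq_cube)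
  qed (simp add: q_def mults_def)
  have "(\<lambda>N. (real d)\<^sup>2 / 6 * (q N * (q N + 1 / real N) * (2 * q N + 1 / real N)))
      \<longlonglongrightarrow> (real d)\<^sup>2 / 6 * (1 / real d * (1 / real d + 0) * (2 * (1 / real d) + 0))"
    unfolding q_def by (intro tendsto_intros div_over_tendsto lim_1_over_n \<open>d > 0\<close>)
  then show "convergent (\<lambda>N. (\<Sum>g\<in>mults N d. (real g)\<^sup>2 * 1) / real N ^ 3)"
    unfolding eq by (rule convergentI)
qed

text \<open>The multiples of \<open>d\<close> divisible by \<open>e\<close> are the multiples of
  \<open>lcm d e\<close>, so the new mean is a linear combination of two means of
  \<open>u\<close>.\<close>

lemma has_means_mult:
  assumes "has_means u" "e > 0"
  shows "has_means (\<lambda>g. u g * (1 - of_bool (e dvd g) / c))"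
  unfolding has_means_def
proof (intro allI impI)
  fix d :: nat assume "d > 0"
  have "(\<Sum>g\<in>mults N d. (real g)\<^sup>2 * (u g * (1 - of_bool (e dvd g) / c))) / real N ^ 3
      = (\<Sum>g\<in>mults N d. (real g)\<^sup>2 * u g) / real N ^ 3
        - (\<Sum>g\<in>mults N (lcm d e). (real g)\<^sup>2 * u g) / real N ^ 3 * (1 / c)" for N
  proof -
    have "(\<Sum>g\<in>mults N (lcm d e). (real g)\<^sup>2 * u g) = (\<Sum>g\<in>mults N d. (real g)\<^sup>2 * u g * of_bool (e dvd g))"
      by (rule sum.mono_neutral_cong_left) (auto simp: mults_def)
    moreover have "(\<Sum>g\<in>mults N d. (real g)\<^sup>2 * (u g * (1 - of_bool (e dvd g) / c)))
        = (\<Sum>g\<in>mults N d. (real g)\<^sup>2 * u g) - (\<Sum>g\<in>mults N d. (real g)\<^sup>2 * u g * of_bool (e dvd g)) * (1 / c)"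
      unfolding sum_distrib_right sum_subtractf [symmetric] by (intro sum.cong) (simp_all add: algebra_simps)
    ultimately show ?thesis by (simp add: diff_divide_distrib)
  qed
  moreover have "convergent (\<lambda>N. (\<Sum>g\<in>mults N d. (real g)\<^sup>2 * u g) / real N ^ 3)"
    using assms(1) \<open>d > 0\<close> by (simp add: has_means_def)
  moreover have "convergent (\<lambda>N. (\<Sum>g\<in>mults N (lcm d e). (real g)\<^sup>2 * u g) / real N ^ 3)"
    using assms \<open>d > 0\<close> by (simp add: has_means_def lcm_pos_nat)
  ultimately show "convergent (\<lambda>N. (\<Sum>g\<in>mults N d. (real g)\<^sup>2 * (u g * (1 - of_bool (e dvd g) / c))) / real N ^ 3)"
    by (simp only:) (intro convergent_diff convergent_mult convergent_const)
qed

section \<open>The Euler product of the totient ratio and its truncation\<close>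

definition tot_ratio :: "nat \<Rightarrow> real" where
  "tot_ratio m = (\<Prod>p\<in>prime_factors m. 1 - 1 / real p)"

text \<open>Restricting the Euler product to the primes up to \<open>y\<close> gives a periodic
  function of \<open>m\<close>, to which \<open>has_means_mult\<close> applies one prime at a
  time.\<close>

definition trunc_ratio :: "nat \<Rightarrow> nat \<Rightarrow> real" where
  "trunc_ratio y m = (\<Prod>p\<in>{p. prime p \<and> p \<le> y}. 1 - of_bool (p dvd m) / real p)"

lemma totient_eq_tot_ratio: "real (totient m) = real m * tot_ratio m"
  by (simp add: totient_formula2 tot_ratio_def)

lemma finite_primes_le [simp]: "finite {p::nat. prime p \<and> p \<le> y}"
  by (rule finite_subset[of _ "{..y}"]) auto

lemma has_means_trunc_ratio:
  assumes "has_means u" "a > 0"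
  shows "has_means (\<lambda>g. u g * trunc_ratio y (g * a))"
proof -
  have "has_means (\<lambda>g. u g * (\<Prod>p\<in>P. 1 - of_bool (p dvd g * a) / real p))"
    if "finite P" "\<And>p. p \<in> P \<Longrightarrow> prime p" for P
    using that
  proof (induction P rule: finite_induct)
    case empty
    then show ?case using assms(1) by simp
  next
    case (insert p P)
    \<comment> \<open>If \<open>p\<close> divides \<open>a\<close> then it divides every
      \<open>g * a\<close>, which is the condition with divisor 1; otherwise it must divide
      \<open>g\<close>.\<close>
    define e where "e = (if p dvd a then 1 else p)"
    have "e > 0" using insert.prems by (auto simp: e_def prime_gt_0_nat)
    have e: "of_bool (p dvd g * a) = of_bool (e dvd g)" for g
      using insert.prems by (auto simp: e_def prime_dvd_mult_iff)
    have "has_means (\<lambda>g. (u g * (\<Prod>p\<in>P. 1 - of_bool (p dvd g * a) / real p)) * (1 - of_bool (e dvd g) / real p))"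
      by (rule has_means_mult) (use insert \<open>e > 0\<close> in auto)
    then show ?case
      using insert by (simp add: e mult_ac)
  qed
  from this[OF finite_primes_le] show ?thesis unfolding trunc_ratio_def by simp
qed

lemma tot_ratio_bounds: "0 \<le> tot_ratio m" "tot_ratio m \<le> 1"
proof -
  have "0 \<le> 1 - 1 / real p \<and> 1 - 1 / real p \<le> 1" if "p \<in> prime_factors m" for p
    using prime_ge_1_nat[OF in_prime_factors_imp_prime[OF that]] by simp
  then show "0 \<le> tot_ratio m" "tot_ratio m \<le> 1"
    unfolding tot_ratio_def by (auto intro!: prod_nonneg prod_le_1)
qed

lemma trunc_ratio_bounds: "0 \<le> trunc_ratio y m" "trunc_ratio y m \<le> 1"
proof -
  have "0 \<le> 1 - of_bool (p dvd m) / real p \<and> 1 - of_bool (p dvd m) / real p \<le> 1" if "prime p" for p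
    using prime_ge_1_nat[of p] that by auto
  then show "0 \<le> trunc_ratio y m" "trunc_ratio y m \<le> 1"
    unfolding trunc_ratio_def by (auto intro!: prod_nonneg prod_le_1)
qed

text \<open>The full product is the truncated one times the product \<open>R\<close> over the prime
  factors above \<open>y\<close>. The Weierstrass inequality bounds 1 - R by the sum of the 1/p, and
  the truncated product is at most 1.\<close>

lemma trunc_ratio_diff:
  assumes "m > 0"
  shows "\<bar>trunc_ratio y m - tot_ratio m\<bar> \<le> (\<Sum>p\<in>{p\<in>prime_factors m. p > y}. 1 / real p)"
proof -
  define B where "B = {p\<in>prime_factors m. p > y}"
  define R where "R = (\<Prod>p\<in>B. 1 - 1 / real p)"
  have "trunc_ratio y m = (\<Prod>p\<in>{p\<in>prime_factors m. p \<le> y}. 1 - 1 / real p)"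
    unfolding trunc_ratio_def using assms
    by (intro prod.mono_neutral_cong_right) (auto simp: prime_factors_dvd)
  moreover have "tot_ratio m = (\<Prod>p\<in>{p\<in>prime_factors m. p \<le> y} \<union> B. 1 - 1 / real p)"
    unfolding tot_ratio_def by (intro prod.cong) (auto simp: B_def)
  moreover have "\<dots> = (\<Prod>p\<in>{p\<in>prime_factors m. p \<le> y}. 1 - 1 / real p) * R"
    unfolding R_def by (rule prod.union_disjoint) (auto simp: B_def)
  ultimately have split: "tot_ratio m = trunc_ratio y m * R" by simp
  have B: "1 / real p \<in> {0..1}" if "p \<in> B" for p
    using that prime_ge_1_nat[of p] by (auto simp: B_def)
  have R: "1 - (\<Sum>p\<in>B. 1 / real p) \<le> R" "R \<le> 1"
    unfolding R_def using Weierstrass_prod_ineq[OF B] B by (auto intro!: prod_le_1)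
  have "trunc_ratio y m - tot_ratio m = trunc_ratio y m * (1 - R)"
    by (simp add: split algebra_simps)
  then have "\<bar>trunc_ratio y m - tot_ratio m\<bar> = trunc_ratio y m * (1 - R)"
    using R trunc_ratio_bounds(1)[of y m] by (simp add: abs_mult)
  also have "\<dots> \<le> 1 * (1 - R)"
    using R trunc_ratio_bounds[of y m] by (intro mult_right_mono) auto
  finally show ?thesis using R by (simp add: B_def)
qed

definition tail :: "nat \<Rightarrow> nat \<Rightarrow> nat \<Rightarrow> real" where
  "tail y N g = (\<Sum>k\<in>{y<..N}. of_bool (k dvd g) / real k)"

text \<open>Since a \<le> y, a prime above \<open>y\<close> cannot divide \<open>a\<close> and must
  divide \<open>g\<close>. This makes the bound independent of \<open>a\<close>.\<close>

lemma trunc_ratio_diff_le_tail: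
  assumes "0 < a" "a \<le> y" "0 < g" "g \<le> N"
  shows "\<bar>trunc_ratio y (g * a) - tot_ratio (g * a)\<bar> \<le> tail y N g"
proof -
  have "p dvd g" if "p \<in> prime_factors (g * a)" "p > y" for p
  proof -
    have "prime p" "p dvd g * a" using that by (auto simp: prime_factors_dvd)
    moreover have "\<not> p dvd a" using that(2) assms by (auto dest: dvd_imp_le)
    ultimately show ?thesis by (simp add: prime_dvd_mult_iff)
  qed
  moreover have "k \<le> N" if "k dvd g" for k
    using that assms by (meson dvd_imp_le le_trans)
  ultimately have sub: "{p\<in>prime_factors (g * a). p > y} \<subseteq> {k\<in>{y<..N}. k dvd g}"
    by auto
  have "\<bar>trunc_ratio y (g * a) - tot_ratio (g * a)\<bar> \<le> (\<Sum>p\<in>{p\<in>prime_factors (g * a). p > y}. 1 / real p)"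
    by (rule trunc_ratio_diff) (use assms in simp)
  also have "\<dots> \<le> (\<Sum>k\<in>{k\<in>{y<..N}. k dvd g}. 1 / real k)"
    by (rule sum_mono2[OF _ sub]) auto
  also have "\<dots> = tail y N g"
    unfolding tail_def by (rule sum.mono_neutral_cong_left) auto
  finally show ?thesis .
qed

text \<open>Telescoping: 1/(n+1)^2 is at most 1/n - 1/(n+1).\<close>

lemma sum_inverse_squares:
  assumes "0 < y" "y \<le> N"
  shows "(\<Sum>k\<in>{y<..N}. 1 / (real k)\<^sup>2) \<le> 1 / real y - 1 / real N"
  using assms(2)
proof (induction N rule: dec_induct)
  case (step n)
  have "{y<..Suc n} = insert (Suc n) {y<..n}" using step by auto
  then have "(\<Sum>k\<in>{y<..Suc n}. 1 / (real k)\<^sup>2) \<le> 1 / (real (Suc n))\<^sup>2 + (1 / real y - 1 / real n)"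
    using step.IH by simp
  also have "1 / (real (Suc n))\<^sup>2 \<le> 1 / (real n * real (Suc n))"
    using assms step by (intro divide_left_mono) (auto simp: power2_eq_square)
  also have "1 / (real n * real (Suc n)) = 1 / real n - 1 / real (Suc n)"
    using assms step by (simp add: field_simps)
  finally show ?case by simp
qed simp

text \<open>After exchanging the sums, each \<open>k\<close> has \<open>N div k\<close> multiples up
  to \<open>N\<close>, each weighted by 1/k.\<close>

lemma sum_tail: "(\<Sum>g\<in>{1..N}. tail y N g) \<le> real N * (\<Sum>k\<in>{y<..N}. 1 / (real k)\<^sup>2)"
proof -
  have "(\<Sum>g\<in>{1..N}. tail y N g) = (\<Sum>k\<in>{y<..N}. \<Sum>g\<in>{1..N}. of_bool (k dvd g) / real k)"
    unfolding tail_def by (rule sum.swap)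
  also have "\<dots> \<le> (\<Sum>k\<in>{y<..N}. real N * (1 / (real k)\<^sup>2))"
  proof (rule sum_mono)
    fix k assume "k \<in> {y<..N}"
    then have "k > 0" by auto
    have "(\<Sum>g\<in>{1..N}. of_bool (k dvd g) / real k) = (\<Sum>g\<in>mults N k. 1 / real k)"
      by (rule sum.mono_neutral_cong_right) (auto simp: mults_def)
    also have "\<dots> = real (N div k) / real k" using \<open>k > 0\<close> by (simp add: card_mults)
    also have "\<dots> \<le> (real N / real k) / real k"
      by (intro divide_right_mono of_nat_div_le_of_nat) auto
    finally show "(\<Sum>g\<in>{1..N}. of_bool (k dvd g) / real k) \<le> real N * (1 / (real k)\<^sup>2)"
      by (simp add: power2_eq_square)
  qed
  finally show ?thesis by (simp add: sum_distrib_left)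
qed

section \<open>The summatory function of totient products\<close>

definition tot_sum :: "nat \<Rightarrow> nat \<Rightarrow> nat \<Rightarrow> real" where
  "tot_sum a b N = (\<Sum>g\<in>{1..N}. real (totient (g * a)) * real (totient (g * b)))"

text \<open>Replacing the two ratios one after the other costs at most \<open>2 * tail y N g\<close>
  for each \<open>g\<close>, and the tails sum to at most N/y. The error bound does not depend on
  \<open>N\<close>, so it can be made small by choosing \<open>y\<close>.\<close>

lemma tot_sum_approx:
  assumes "0 < a" "0 < b" "a \<le> y" "b \<le> y"
  shows "\<bar>tot_sum a b N / real N ^ 3 -
      real (a * b) * ((\<Sum>g\<in>mults N 1. (real g)\<^sup>2 * (trunc_ratio y (g * a) * trunc_ratio y (g * b))) / real N ^ 3)\<bar>
      \<le> 2 * real (a * b) / real y"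
proof (cases "N = 0")
  case False
  define D where "D g = tot_ratio (g * a) * tot_ratio (g * b) - trunc_ratio y (g * a) * trunc_ratio y (g * b)" for g
  have D: "\<bar>D g\<bar> \<le> 2 * tail y N g" if "g \<in> {1..N}" for g
  proof -
    have "D g = tot_ratio (g * a) * (tot_ratio (g * b) - trunc_ratio y (g * b))
        + trunc_ratio y (g * b) * (tot_ratio (g * a) - trunc_ratio y (g * a))"
      by (simp add: D_def algebra_simps)
    also have "\<bar>\<dots>\<bar> \<le> 1 * tail y N g + 1 * tail y N g"
      using assms that
        trunc_ratio_diff_le_tail[of a y g N, unfolded abs_minus_commute[of "trunc_ratio y (g * a)"]]
        trunc_ratio_diff_le_tail[of b y g N, unfolded abs_minus_commute[of "trunc_ratio y (g * b)"]]
        tot_ratio_bounds[of "g * a"] trunc_ratio_bounds[of y "g * b"]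
      by (intro order_trans[OF abs_triangle_ineq] add_mono; unfold abs_mult; intro mult_mono) auto
    finally show ?thesis by simp
  qed
  have tail: "(\<Sum>g\<in>{1..N}. tail y N g) \<le> real N / real y"
  proof (cases "y \<le> N")
    case True
    have "(\<Sum>k\<in>{y<..N}. 1 / (real k)\<^sup>2) \<le> 1 / real y - 1 / real N"
      by (rule sum_inverse_squares) (use assms True in auto)
    also have "\<dots> \<le> 1 / real y" by simp
    finally have "real N * (\<Sum>k\<in>{y<..N}. 1 / (real k)\<^sup>2) \<le> real N * (1 / real y)"
      by (rule mult_left_mono) simp
    then show ?thesis using sum_tail[of y N] by simp
  qed (simp add: tail_def)
  have "mults N 1 = {1..N}" by (auto simp: mults_def)
  then have "tot_sum a b N / real N ^ 3 -
      real (a * b) * ((\<Sum>g\<in>mults N 1. (real g)\<^sup>2 * (trunc_ratio y (g * a) * trunc_ratio y (g * b))) / real N ^ 3)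
      = real (a * b) * (\<Sum>g\<in>{1..N}. (real g)\<^sup>2 * D g) / real N ^ 3"
    unfolding tot_sum_def D_def totient_eq_tot_ratio
    by (simp add: sum_distrib_left right_diff_distrib sum_subtractf diff_divide_distrib power2_eq_square mult_ac)
  also have "\<bar>\<dots>\<bar> = real (a * b) * \<bar>\<Sum>g\<in>{1..N}. (real g)\<^sup>2 * D g\<bar> / real N ^ 3"
    by (simp add: abs_mult)
  also have "\<bar>\<Sum>g\<in>{1..N}. (real g)\<^sup>2 * D g\<bar> \<le> (\<Sum>g\<in>{1..N}. (real N)\<^sup>2 * (2 * tail y N g))"
  proof (rule order_trans[OF sum_abs sum_mono])
    fix g assume g: "g \<in> {1..N}"
    then show "\<bar>(real g)\<^sup>2 * D g\<bar> \<le> (real N)\<^sup>2 * (2 * tail y N g)"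
      using D[OF g] by (auto simp: abs_mult intro!: mult_mono power_mono)
  qed
  also have "\<dots> = 2 * (real N)\<^sup>2 * (\<Sum>g\<in>{1..N}. tail y N g)"
    unfolding sum_distrib_left by (intro sum.cong) simp_all
  also have "\<dots> \<le> 2 * (real N)\<^sup>2 * (real N / real y)"
    by (intro mult_left_mono tail) simp
  also have "real (a * b) * \<dots> / real N ^ 3 = 2 * real (a * b) / real y"
    using False by (simp add: power2_eq_square power3_eq_cube)
  finally show ?thesis by (simp add: divide_right_mono mult_left_mono)
qed (simp add: tot_sum_def)

lemma convergent_tot_sum:
  assumes "0 < a" "0 < b"
  shows "convergent (\<lambda>N. tot_sum a b N / real N ^ 3)"
proof (rule convergent_approx)
  fix e :: real assume "e > 0"
  define y where "y = max (max a b) (nat \<lceil>2 * real (a * b) / e\<rceil>)"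
  have "2 * real (a * b) / e \<le> real y" unfolding y_def by linarith
  moreover have y: "a \<le> y" "b \<le> y" "y > 0" using assms by (auto simp: y_def)
  ultimately have "2 * real (a * b) / real y \<le> e"
    using \<open>e > 0\<close> by (simp add: field_simps)
  moreover have "has_means (\<lambda>g. trunc_ratio y (g * a) * trunc_ratio y (g * b))"
    using has_means_trunc_ratio[OF has_means_trunc_ratio[OF has_means_1 assms(1)] assms(2)] by simp
  then have "convergent (\<lambda>N. real (a * b) *
      ((\<Sum>g\<in>mults N 1. (real g)\<^sup>2 * (trunc_ratio y (g * a) * trunc_ratio y (g * b))) / real N ^ 3))"
    unfolding has_means_def by (intro convergent_mult convergent_const) auto
  ultimately show "\<exists>h. convergent h \<and> (\<forall>\<^sub>F N in sequentially. \<bar>tot_sum a b N / real N ^ 3 - h N\<bar> \<le> e)"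
    using tot_sum_approx[OF assms y(1,2)] by (blast intro: always_eventually order_trans)
qed

text \<open>The ratios average at least 1/4, because a ratio is at least 1 minus its tail. A tangent
  line to the square then gives a lower bound for the squares, once the small \<open>g\<close> are
  discarded.\<close>

lemma tot_sum_1_1_ge: "real N ^ 3 / 4096 \<le> tot_sum 1 1 N"
proof (cases "N \<ge> 2")
  case True
  \<comment> \<open>The term k = 2 is split off because telescoping from 1 would give only the bound
    1, from which no positive average follows.\<close>
  have "{1<..N} = insert 2 {2<..N}" using True by auto
  then have "(\<Sum>k\<in>{1<..N}. 1 / (real k)\<^sup>2) = 1 / 4 + (\<Sum>k\<in>{2<..N}. 1 / (real k)\<^sup>2)" by simp
  also have "\<dots> \<le> 1 / 4 + (1 / 2 - 1 / real N)"
    using sum_inverse_squares[of 2 N] True by simp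
  also have "\<dots> \<le> 3 / 4" by simp
  finally have "real N * (\<Sum>k\<in>{1<..N}. 1 / (real k)\<^sup>2) \<le> real N * (3 / 4)"
    by (rule mult_left_mono) simp
  then have tail: "(\<Sum>g\<in>{1..N}. tail 1 N g) \<le> 3 / 4 * real N"
    using sum_tail[of 1 N] by simp
  have "trunc_ratio 1 g = 1" for g
    by (auto simp: trunc_ratio_def prime_nat_iff intro!: prod.neutral)
  then have "1 - tail 1 N g \<le> tot_ratio g" if "g \<in> {1..N}" for g
    using trunc_ratio_diff_le_tail[of 1 1 g N] that by auto
  then have "(\<Sum>g\<in>{1..N}. 1 - tail 1 N g) \<le> (\<Sum>g\<in>{1..N}. tot_ratio g)"
    by (rule sum_mono)
  then have ratio: "real N / 4 \<le> (\<Sum>g\<in>{1..N}. tot_ratio g)"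
    using tail by (simp add: sum_subtractf)
  \<comment> \<open>The line r/4 - 1/64 is tangent to r^2 at r = 1/8. Subtracting 15/64, its value
    at r = 1, makes the weight nonpositive where 8 g \<le> N; for the other \<open>g\<close> one has
    g^2 \<ge> N^2/64. The total is at least (1/16 - 1/64 - 15/512) N = 9 N/512, hence at least
    N/64.\<close>
  let ?w = "\<lambda>g. tot_ratio g / 4 - 1 / 64 - (if 8 * g \<le> N then 15 / 64 else 0)"
  have w: "(real N)\<^sup>2 / 64 * ?w g \<le> real (totient (g * 1)) * real (totient (g * 1))" for g
  proof (cases "8 * g \<le> N")
    case True
    then have "?w g \<le> 0" using tot_ratio_bounds(2)[of g] by simp
    then have "(real N)\<^sup>2 / 64 * ?w g \<le> 0" by (simp add: mult_nonneg_nonpos)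
    then show ?thesis by (meson of_nat_0_le_iff order_trans mult_nonneg_nonneg)
  next
    case False
    then have "(real N)\<^sup>2 \<le> (8 * real g)\<^sup>2" by (intro power_mono) auto
    then have g2: "(real N)\<^sup>2 / 64 \<le> (real g)\<^sup>2" by (simp add: power_mult_distrib)
    have "0 \<le> (tot_ratio g - 1 / 8)\<^sup>2" by simp
    then have "?w g \<le> (tot_ratio g)\<^sup>2" using False by (simp add: power2_eq_square algebra_simps)
    then have "(real N)\<^sup>2 / 64 * ?w g \<le> (real N)\<^sup>2 / 64 * (tot_ratio g)\<^sup>2" by (rule mult_left_mono) simp
    also have "\<dots> \<le> (real g)\<^sup>2 * (tot_ratio g)\<^sup>2" by (rule mult_right_mono[OF g2]) simp
    finally show ?thesis by (simp add: totient_eq_tot_ratio power2_eq_square mult_ac)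
  qed
  have "(\<Sum>g\<in>{1..N}. if 8 * g \<le> N then 15 / 64 else 0 :: real) = (\<Sum>g\<in>{1..N div 8}. 15 / 64)"
    by (rule sum.mono_neutral_cong_right) (auto simp: less_eq_div_iff_mult_less_eq mult.commute)
  also have "\<dots> \<le> 15 / 64 * (real N / 8)"
    using of_nat_div_le_of_nat[of N 8] by simp
  finally have "real N / 4 / 4 - real N / 64 - 15 / 64 * (real N / 8) \<le> (\<Sum>g\<in>{1..N}. ?w g)"
    using ratio by (simp add: sum_subtractf flip: sum_divide_distrib)
  then have "real N / 64 \<le> (\<Sum>g\<in>{1..N}. ?w g)" by linarith
  then have "(real N)\<^sup>2 / 64 * (real N / 64) \<le> (real N)\<^sup>2 / 64 * (\<Sum>g\<in>{1..N}. ?w g)"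
    by (rule mult_left_mono) simp
  also have "\<dots> \<le> tot_sum 1 1 N"
    unfolding tot_sum_def sum_distrib_left by (rule sum_mono) (rule w)
  finally show ?thesis by (simp add: power2_eq_square power3_eq_cube)
next
  case False
  then consider "N = 0" | "N = 1" by linarith
  then show ?thesis by cases (simp_all add: tot_sum_def)
qed

section \<open>The limit of the variance\<close>

text \<open>The difference factors as (1 - \<alpha>)^w times 1 - (1 - \<alpha>)^z with w = x + y -
  z; the linear bound is Bernoulli's inequality.\<close>

lemma power_diff_bounds:
  fixes \<alpha> :: real
  assumes "\<alpha> \<in> {0..1}" "z \<le> x"
  shows "0 \<le> (1 - \<alpha>) ^ (x + y - z) - (1 - \<alpha>) ^ (x + y)"
    and "(1 - \<alpha>) ^ (x + y - z) - (1 - \<alpha>) ^ (x + y) \<le> 1"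
    and "(1 - \<alpha>) ^ (x + y - z) - (1 - \<alpha>) ^ (x + y) \<le> \<alpha> * real z"
proof -
  define w where "w = x + y - z"
  have "x + y = w + z" using assms by (simp add: w_def)
  then have eq: "(1 - \<alpha>) ^ (x + y - z) - (1 - \<alpha>) ^ (x + y) = (1 - \<alpha>) ^ w * (1 - (1 - \<alpha>) ^ z)"
    unfolding w_def [symmetric] \<open>x + y = w + z\<close> by (simp add: power_add algebra_simps)
  have pow: "0 \<le> (1 - \<alpha>) ^ k" "(1 - \<alpha>) ^ k \<le> 1" for k
    using assms by (auto intro: power_le_one)
  have "1 - real z * \<alpha> \<le> (1 - \<alpha>) ^ z"
    using Bernoulli_inequality[of "- \<alpha>" z] assms by simp
  then have z: "1 - (1 - \<alpha>) ^ z \<le> \<alpha> * real z" by (simp add: mult.commute)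
  show "0 \<le> (1 - \<alpha>) ^ (x + y - z) - (1 - \<alpha>) ^ (x + y)"
    unfolding eq using pow[of w] pow[of z] by simp
  have le: "(1 - \<alpha>) ^ w * (1 - (1 - \<alpha>) ^ z) \<le> 1 * (1 - (1 - \<alpha>) ^ z)"
    using pow[of w] pow[of z] by (intro mult_right_mono) auto
  show "(1 - \<alpha>) ^ (x + y - z) - (1 - \<alpha>) ^ (x + y) \<le> 1"
    unfolding eq using le pow[of z] by simp
  show "(1 - \<alpha>) ^ (x + y - z) - (1 - \<alpha>) ^ (x + y) \<le> \<alpha> * real z"
    unfolding eq using le z by simp
qed

definition pair_cov :: "real \<Rightarrow> nat \<Rightarrow> nat \<Rightarrow> nat \<Rightarrow> real" where
  "pair_cov \<beta> a b m = \<beta> ^ (m div a + m div b - m div (a * b)) - \<beta> ^ (m div a + m div b)"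

text \<open>The lcm of g a and g b is g a b, and \<open>n div (g * k)\<close> equals
  \<open>n div g div k\<close>, so \<open>g\<close> enters only through
  \<open>n div g\<close>.\<close>

lemma cov_mult_coprime:
  assumes "coprime a b"
  shows "cov \<beta> n (g * a) (g * b) = pair_cov \<beta> a b (n div g)"
proof -
  have "lcm (g * a) (g * b) = g * (a * b)"
    using assms by (simp add: lcm_mult_left lcm_coprime)
  then show ?thesis by (simp add: cov_def pair_cov_def div_mult2_eq)
qed

lemma pair_cov_bounds:
  assumes "\<alpha> \<in> {0..1}"
  shows "0 \<le> pair_cov (1 - \<alpha>) a b m" "pair_cov (1 - \<alpha>) a b m \<le> 1"
    "pair_cov (1 - \<alpha>) a b m \<le> \<alpha> * real (m div (a * b))"
  unfolding pair_cov_def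
  by (rule power_diff_bounds[OF assms]; simp add: div_mult2_eq)+

lemma cov_nonneg:
  assumes "\<alpha> \<in> {0..1}" "0 < d" "0 < e"
  shows "0 \<le> cov (1 - \<alpha>) n d e"
  unfolding cov_def
  by (rule power_diff_bounds[OF assms(1)], rule div_le_mono2[OF assms(2)])
     (use assms in \<open>auto intro: dvd_imp_le simp: lcm_pos_nat\<close>)

section \<open>Regrouping the variance by coprime pairs\<close>

definition pair_sum :: "nat \<Rightarrow> real \<Rightarrow> nat \<times> nat \<Rightarrow> real" where
  "pair_sum n \<alpha> = (\<lambda>(a, b). \<Sum>g\<in>{g\<in>{1..n div (a * b)}. 2 \<le> g * a \<and> 2 \<le> g * b}.
     real (totient (g * a)) * real (totient (g * b)) * pair_cov (1 - \<alpha>) a b (n div g))"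

definition coprime_pairs :: "nat \<Rightarrow> (nat \<times> nat) set" where
  "coprime_pairs N = {(a, b)\<in>{1..N} \<times> {1..N}. coprime a b}"

lemma finite_coprime_pairs [simp]: "finite (coprime_pairs N)"
  by (rule finite_subset[of _ "{1..N} \<times> {1..N}"]) (auto simp: coprime_pairs_def)

text \<open>Each (d, e) corresponds to its gcd \<open>g\<close> and the coprime cofactors (a, b).
  Pairs with lcm above \<open>n\<close> have covariance 0, which gives the cutoff g \<le> n div (a
  b); the two lower bounds in \<open>pair_sum\<close> keep d and e at least 2.\<close>

lemma VarX_B_eq_pair_sum: "VarX_B n \<alpha> = (\<Sum>ab\<in>coprime_pairs n. pair_sum n \<alpha> ab)"
proof -
  define h where "h = (\<lambda>(d, e). real (totient d) * real (totient e) * cov (1 - \<alpha>) n d e)"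
  define D where "D = {(d, e)\<in>{2..n} \<times> {2..n}. lcm d e \<le> n}"
  define G where "G = (\<lambda>(a, b). {g\<in>{1..n div (a * b)}. 2 \<le> g * a \<and> 2 \<le> g * b})"
  have "VarX_B n \<alpha> = (\<Sum>x\<in>{2..n} \<times> {2..n}. h x)"
    by (simp add: VarX_B_eq sum.cartesian_product h_def)
  also have "\<dots> = (\<Sum>x\<in>D. h x)"
  proof (rule sum.mono_neutral_right)
    have "(d, e) \<in> D \<or> h (d, e) = 0" if "d \<in> {2..n}" "e \<in> {2..n}" for d e
      using that by (cases "lcm d e \<le> n") (simp_all add: D_def h_def cov_def)
    then show "\<forall>x\<in>{2..n} \<times> {2..n} - D. h x = 0" by blast
  qed (auto simp: D_def)
  also have "\<dots> = (\<Sum>y\<in>Sigma (coprime_pairs n) G. h (snd y * fst (fst y), snd y * snd (fst y)))"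
  proof (rule sum.reindex_bij_witness[where
        i = "\<lambda>y. (snd y * fst (fst y), snd y * snd (fst y))" and
        j = "\<lambda>(d, e). ((d div gcd d e, e div gcd d e), gcd d e)"])
    fix x assume "x \<in> D"
    then obtain d e where x: "x = (d, e)" "2 \<le> d" "d \<le> n" "2 \<le> e" "e \<le> n" "lcm d e \<le> n"
      by (auto simp: D_def)
    define g a b where "g = gcd d e" and "a = d div g" and "b = e div g"
    have de: "d = g * a" "e = g * b" by (simp_all add: g_def a_def b_def)
    then have pos: "g > 0" "a > 0" "b > 0" using x by (auto intro!: Nat.gr0I)
    have "coprime a b"
      unfolding a_def b_def g_def using x by (intro div_gcd_coprime) auto
    then have "lcm d e = g * (a * b)" by (simp add: de lcm_mult_left lcm_coprime)
    then have "g \<le> n div (a * b)" using x pos by (simp add: less_eq_div_iff_mult_less_eq)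
    moreover have "a \<le> n" "b \<le> n"
      unfolding a_def b_def using x div_le_dividend le_trans by blast+
    ultimately have "((a, b), g) \<in> Sigma (coprime_pairs n) G"
      using pos x \<open>coprime a b\<close> de by (auto simp: coprime_pairs_def G_def Suc_le_eq)
    then show "(case x of (d, e) \<Rightarrow> ((d div gcd d e, e div gcd d e), gcd d e)) \<in> Sigma (coprime_pairs n) G"
      by (simp add: x g_def a_def b_def)
  next
    fix y assume "y \<in> Sigma (coprime_pairs n) G"
    then obtain a b g where y: "y = ((a, b), g)" "1 \<le> a" "1 \<le> b" "coprime a b" "1 \<le> g"
      "g \<le> n div (a * b)" "2 \<le> g * a" "2 \<le> g * b"
      by (auto simp: coprime_pairs_def G_def)
    have "gcd (g * a) (g * b) = g" using y by (simp add: gcd_mult_left)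
    then show "(case (snd y * fst (fst y), snd y * snd (fst y)) of (d, e) \<Rightarrow>
        ((d div gcd d e, e div gcd d e), gcd d e)) = y"
      using y by simp
    have lcm: "lcm (g * a) (g * b) = g * (a * b)" using y by (simp add: lcm_mult_left lcm_coprime)
    have le: "g * (a * b) \<le> n" using y by (simp add: less_eq_div_iff_mult_less_eq)
    have "g * a \<le> g * (a * b)" "g * b \<le> g * (a * b)" using y by simp_all
    with le have "g * a \<le> n" "g * b \<le> n" by linarith+
    then show "(snd y * fst (fst y), snd y * snd (fst y)) \<in> D"
      using y lcm le by (simp add: D_def)
  qed auto
  also have "\<dots> = (\<Sum>ab\<in>coprime_pairs n. \<Sum>g\<in>G ab. h (g * fst ab, g * snd ab))"
    by (subst sum.Sigma) (auto simp: G_def case_prod_unfold)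
  also have "\<dots> = (\<Sum>ab\<in>coprime_pairs n. pair_sum n \<alpha> ab)"
    by (intro sum.cong refl)
       (auto simp: coprime_pairs_def pair_sum_def G_def h_def cov_mult_coprime)
  finally show ?thesis .
qed

lemma totient_prod_le:
  "real (totient (g * a)) * real (totient (g * b)) \<le> real (a * b) * (real g)\<^sup>2"
proof -
  have "real (totient (g * a)) * real (totient (g * b)) \<le> real (g * a) * real (g * b)"
    by (intro mult_mono) (simp_all only: of_nat_le_iff totient_le of_nat_0_le_iff)
  then show ?thesis by (simp add: power2_eq_square mult_ac)
qed

lemma pair_sum_nonneg: "\<alpha> \<in> {0..1} \<Longrightarrow> 0 \<le> pair_sum n \<alpha> ab"
  unfolding pair_sum_def case_prod_unfold
  by (intro sum_nonneg mult_nonneg_nonneg pair_cov_bounds) auto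

text \<open>The totients contribute at most a b g^2 and the covariance at most \<alpha> n/(g a b),
  so each term is at most \<alpha> n g. With g \<le> K this totals at most \<alpha> n K^2, where K
  \<le> n/(a b).\<close>

lemma pair_sum_le:
  assumes "\<alpha> \<in> {0..1}" "0 < a" "0 < b"
  shows "pair_sum n \<alpha> (a, b) \<le> \<alpha> * real n ^ 3 * (1 / (real a)\<^sup>2 * (1 / (real b)\<^sup>2))"
proof -
  define K where "K = n div (a * b)"
  have K: "real K \<le> real n / real (a * b)" unfolding K_def by (rule of_nat_div_le_of_nat)
  have term_le: "real (totient (g * a)) * real (totient (g * b)) * pair_cov (1 - \<alpha>) a b (n div g)
      \<le> \<alpha> * real n * real K" if "g \<in> {1..K}" for g
  proof -
    have "real (n div g div (a * b)) \<le> real n / (real g * real (a * b))"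
      using of_nat_div_le_of_nat[of n "g * (a * b)", where ?'a = real]
      by (simp add: div_mult2_eq[of n g "a * b"])
    then have "pair_cov (1 - \<alpha>) a b (n div g) \<le> \<alpha> * (real n / (real g * real (a * b)))"
      using assms pair_cov_bounds(3)[OF assms(1), of a b "n div g"]
      by (meson atLeastAtMost_iff mult_left_mono order_trans)
    then have "real (totient (g * a)) * real (totient (g * b)) * pair_cov (1 - \<alpha>) a b (n div g)
      \<le> real (a * b) * (real g)\<^sup>2 * (\<alpha> * (real n / (real g * real (a * b))))"
      using pair_cov_bounds(1)[OF assms(1)] by (intro mult_mono totient_prod_le) auto
    also have "\<dots> = \<alpha> * real n * real g"
      using assms that by (simp add: power2_eq_square)
    also have "\<dots> \<le> \<alpha> * real n * real K" using assms that by (intro mult_left_mono) auto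
    finally show ?thesis .
  qed
  have "pair_sum n \<alpha> (a, b) \<le> (\<Sum>g\<in>{g\<in>{1..K}. 2 \<le> g * a \<and> 2 \<le> g * b}. \<alpha> * real n * real K)"
    unfolding pair_sum_def prod.case K_def [symmetric] by (intro sum_mono term_le) auto
  also have "\<dots> \<le> (\<Sum>g\<in>{1..K}. \<alpha> * real n * real K)"
    using assms by (intro sum_mono2) auto
  also have "\<dots> = \<alpha> * real n * (real K)\<^sup>2" by (simp add: power2_eq_square)
  also have "\<dots> \<le> \<alpha> * real n * (real n / real (a * b))\<^sup>2"
    using assms K by (intro mult_left_mono power_mono) auto
  also have "\<dots> = \<alpha> * real n ^ 3 * (1 / (real a)\<^sup>2 * (1 / (real b)\<^sup>2))"
    by (simp add: power2_eq_square power3_eq_cube mult_ac)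
  finally show ?thesis .
qed

section \<open>The upper bound of order \<alpha> n^3\<close>

definition inv_squares :: "nat \<Rightarrow> real" where
  "inv_squares n = (\<Sum>k\<in>{1..n}. 1 / (real k)\<^sup>2)"

lemma inv_squares_diff:
  assumes "0 < K" "K \<le> n"
  shows "inv_squares n - inv_squares K \<le> 1 / real K"
proof -
  have "{1..n} = {1..K} \<union> {K<..n}" using assms by auto
  then have "inv_squares n = inv_squares K + (\<Sum>k\<in>{K<..n}. 1 / (real k)\<^sup>2)"
    unfolding inv_squares_def by (simp only:) (rule sum.union_disjoint; auto)
  moreover have "(\<Sum>k\<in>{K<..n}. 1 / (real k)\<^sup>2) \<le> 1 / real K - 1 / real n"
    by (rule sum_inverse_squares[OF assms])
  moreover have "0 \<le> 1 / real n" by simp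
  ultimately show ?thesis by linarith
qed

lemma inv_squares_bounds: "0 \<le> inv_squares n" "inv_squares n \<le> 2"
proof -
  show "0 \<le> inv_squares n" by (simp add: inv_squares_def sum_nonneg)
  show "inv_squares n \<le> 2"
  proof (cases "n = 0")
    case False
    then show ?thesis using inv_squares_diff[of 1 n] by (simp add: inv_squares_def)
  qed (simp add: inv_squares_def)
qed

lemma sum_pairs_inv_squares:
  "(\<Sum>(a, b)\<in>{1..n} \<times> {1..n}. 1 / (real a)\<^sup>2 * (1 / (real b)\<^sup>2)) = (inv_squares n)\<^sup>2"
  by (simp add: inv_squares_def power2_eq_square sum_product sum.cartesian_product del: times_divide_eq_right)

text \<open>Dropping coprimality factors the sum over pairs into the square of
  \<open>inv_squares n\<close>, which is at most 2; hence the constant 4.\<close>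

lemma VarX_B_le:
  assumes "\<alpha> \<in> {0..1}"
  shows "VarX_B n \<alpha> \<le> 4 * \<alpha> * real n ^ 3"
proof -
  have "VarX_B n \<alpha> \<le> (\<Sum>(a, b)\<in>coprime_pairs n. \<alpha> * real n ^ 3 * (1 / (real a)\<^sup>2 * (1 / (real b)\<^sup>2)))"
    unfolding VarX_B_eq_pair_sum
    by (intro sum_mono) (use pair_sum_le[OF assms] in \<open>auto simp: coprime_pairs_def\<close>)
  also have "\<dots> \<le> (\<Sum>(a, b)\<in>{1..n} \<times> {1..n}. \<alpha> * real n ^ 3 * (1 / (real a)\<^sup>2 * (1 / (real b)\<^sup>2)))"
    using assms by (intro sum_mono2) (auto simp: coprime_pairs_def)
  also have "\<dots> = \<alpha> * real n ^ 3 * (inv_squares n)\<^sup>2"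
    unfolding sum_pairs_inv_squares [symmetric] sum_distrib_left by (simp add: case_prod_unfold)
  also have "\<dots> \<le> \<alpha> * real n ^ 3 * 2\<^sup>2"
    using assms inv_squares_bounds by (intro mult_left_mono power_mono) auto
  finally show ?thesis by simp
qed

section \<open>Blocks on which the floor of n/g is constant\<close>

lemma tot_sum_diff:
  assumes "l \<le> u"
  shows "(\<Sum>g\<in>{l<..u}. real (totient (g * a)) * real (totient (g * b))) = tot_sum a b u - tot_sum a b l"
proof -
  have "{1..u} = {1..l} \<union> {l<..u}" using assms by auto
  then have "tot_sum a b u = tot_sum a b l + (\<Sum>g\<in>{l<..u}. real (totient (g * a)) * real (totient (g * b)))"
    unfolding tot_sum_def by (simp only:) (rule sum.union_disjoint; auto)
  then show ?thesis by simp
qed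

lemma div_eq_if_between:
  fixes n m g :: nat
  assumes "g \<in> {n div Suc m<..n div m}" "m > 0"
  shows "n div g = m"
proof (rule div_nat_eqI)
  show "g * m \<le> n" using assms by (simp add: less_eq_div_iff_mult_less_eq)
  show "n < g * Suc m"
    using assms(1) by (metis greaterThanAtMost_iff div_less_iff_less_mult zero_less_Suc)
qed

lemma sum_by_div:
  fixes f :: "nat \<Rightarrow> real"
  assumes "0 < k" "k \<le> M"
  shows "(\<Sum>g\<in>{n div Suc M<..n div k}. f g * h (n div g)) =
    (\<Sum>m\<in>{k..M}. h m * (\<Sum>g\<in>{n div Suc m<..n div m}. f g))"
proof -
  have block: "(\<Sum>g\<in>{n div Suc m<..n div m}. f g * h (n div g)) =
      h m * (\<Sum>g\<in>{n div Suc m<..n div m}. f g)" if "m > 0" for m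
    unfolding sum_distrib_left
  proof (rule sum.cong)
    fix g assume "g \<in> {n div Suc m<..n div m}"
    then have "n div g = m" using that by (rule div_eq_if_between)
    then show "f g * h (n div g) = h m * f g" by (simp only: mult.commute)
  qed simp
  show ?thesis
    using assms(2)
  proof (induction M rule: dec_induct)
    case base
    show ?case
      using block[OF assms(1)] by simp
  next
    case (step M)
    have "{n div Suc (Suc M)<..n div k} = {n div Suc M<..n div k} \<union> {n div Suc (Suc M)<..n div Suc M}"
      using div_le_mono2[of "Suc M" "Suc (Suc M)" n] div_le_mono2[of k "Suc M" n] step assms by auto
    then have "(\<Sum>g\<in>{n div Suc (Suc M)<..n div k}. f g * h (n div g)) =
        (\<Sum>g\<in>{n div Suc M<..n div k}. f g * h (n div g)) +
        (\<Sum>g\<in>{n div Suc (Suc M)<..n div Suc M}. f g * h (n div g))"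
      by (simp only:) (rule sum.union_disjoint; auto)
    also have "(\<Sum>g\<in>{n div Suc (Suc M)<..n div Suc M}. f g * h (n div g)) =
        h (Suc M) * (\<Sum>g\<in>{n div Suc (Suc M)<..n div Suc M}. f g)"
      by (rule block) simp
    finally show ?case using step by simp
  qed
qed

lemma filterlim_div_at_top:
  assumes "m > 0"
  shows "filterlim (\<lambda>n::nat. n div m) at_top sequentially"
  unfolding filterlim_at_top
proof
  fix Z
  show "\<forall>\<^sub>F n in sequentially. Z \<le> n div m"
    using eventually_ge_at_top[of "Z * m"] by eventually_elim (simp add: assms less_eq_div_iff_mult_less_eq)
qed

lemma tot_sum_div_tendsto:
  assumes "(\<lambda>N. tot_sum a b N / real N ^ 3) \<longlonglongrightarrow> c" "m > 0"
  shows "(\<lambda>n. tot_sum a b (n div m) / real n ^ 3) \<longlonglongrightarrow> c * (1 / real m) ^ 3"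
proof -
  have "(\<lambda>n. tot_sum a b (n div m) / real (n div m) ^ 3 * (real (n div m) / real n) ^ 3)
      \<longlonglongrightarrow> c * (1 / real m) ^ 3"
    by (intro tendsto_mult tendsto_power div_over_tendsto assms
        filterlim_compose[OF assms(1) filterlim_div_at_top])
  moreover have "tot_sum a b (n div m) / real (n div m) ^ 3 * (real (n div m) / real n) ^ 3
      = tot_sum a b (n div m) / real n ^ 3" for n
    \<comment> \<open>If \<open>n div m = 0\<close>, both sides vanish because the totient sum is
      empty.\<close>
    by (cases "n div m = 0") (simp_all add: tot_sum_def power_divide)
  ultimately show ?thesis by simp
qed

text \<open>For \<open>g\<close> above L = n div (M + 1) only finitely many values of
  \<open>n div g\<close> occur, and each block contributes a bounded function of \<alpha> times a
  convergent sequence. The remaining g \<le> L contribute at most k L^3 \<le> k (n/(M+1))^3.\<close>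

lemma uniformly_convergent_pair_sum:
  assumes "0 < a" "0 < b"
  shows "uniformly_convergent_on {0..1} (\<lambda>n \<alpha>. pair_sum n \<alpha> (a, b) / real n ^ 3)"
proof (rule uniformly_convergent_on_approx)
  fix e :: real assume "e > 0"
  define k where "k = a * b"
  \<comment> \<open>The first summand gives k \<le> M, so that the block indices from k to M form a
    nonempty range; the second makes k/(M+1)^3 at most e.\<close>
  define M where "M = k + nat \<lceil>real k / e\<rceil>"
  have k: "k > 0" "k \<le> M" using assms by (simp_all add: k_def M_def)
  define f where "f g = real (totient (g * a)) * real (totient (g * b))" for g
  define H where "H n \<alpha> = (\<Sum>m\<in>{k..M}. pair_cov (1 - \<alpha>) a b m *
      ((tot_sum a b (n div m) - tot_sum a b (n div Suc m)) / real n ^ 3))" for n \<alpha>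
  have M: "real k / (real (Suc M)) ^ 3 \<le> e"
  proof -
    have "real k / e \<le> real (Suc M)" unfolding M_def by linarith
    then have "real k \<le> e * real (Suc M)" using \<open>e > 0\<close> by (simp add: field_simps)
    also have "\<dots> \<le> e * real (Suc M) ^ 3"
      using \<open>e > 0\<close> by (intro mult_left_mono self_le_power) auto
    finally show ?thesis by (simp add: field_simps)
  qed
  obtain c where c: "(\<lambda>N. tot_sum a b N / real N ^ 3) \<longlonglongrightarrow> c"
    using convergent_tot_sum[OF assms] by (auto simp: convergent_def)
  have "uniformly_convergent_on {0..1} H"
    unfolding H_def
  proof (intro uniformly_convergent_on_sum_finite uniformly_convergent_on_bounded_mult)
    fix m assume "m \<in> {k..M}"
    then have "m > 0" using k by auto
    show "convergent (\<lambda>n. (tot_sum a b (n div m) - tot_sum a b (n div Suc m)) / real n ^ 3)"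
      unfolding diff_divide_distrib
      using tot_sum_div_tendsto[OF c \<open>m > 0\<close>] tot_sum_div_tendsto[OF c, of "Suc m"]
      by (intro convergent_diff) (auto simp: convergent_def)
    fix \<alpha> :: real assume "\<alpha> \<in> {0..1}"
    then show "\<bar>pair_cov (1 - \<alpha>) a b m\<bar> \<le> 1" using pair_cov_bounds[of \<alpha> a b m] by simp
  qed
  moreover have "\<bar>pair_sum n \<alpha> (a, b) / real n ^ 3 - H n \<alpha>\<bar> \<le> e"
    if "n \<ge> Suc M" "\<alpha> \<in> {0..1}" for n \<alpha>
  proof -
    define L where "L = n div Suc M"
    define P where "P g \<longleftrightarrow> 2 \<le> g * a \<and> 2 \<le> g * b" for g
    \<comment> \<open>This is why n \<ge> M + 1 is required: every g > L is then at least 2, and the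
      side conditions in \<open>pair_sum\<close> hold there automatically.\<close>
    have "L \<ge> 1" unfolding L_def using that by (simp add: less_eq_div_iff_mult_less_eq)
    have "L \<le> n div k" unfolding L_def using k by (intro div_le_mono2) auto
    have P: "P g" if "g > L" for g
    proof -
      have "g \<ge> 2" using that \<open>L \<ge> 1\<close> by simp
      then have "2 * 1 \<le> g * a" "2 * 1 \<le> g * b" using assms by (intro mult_le_mono; simp)+
      then show ?thesis by (simp add: P_def)
    qed
    let ?t = "\<lambda>g. f g * pair_cov (1 - \<alpha>) a b (n div g)"
    have "{g\<in>{1..n div k}. P g} = {g\<in>{1..L}. P g} \<union> {L<..n div k}"
      using P \<open>L \<le> n div k\<close> by auto
    then have "pair_sum n \<alpha> (a, b) = (\<Sum>g\<in>{g\<in>{1..L}. P g}. ?t g) + (\<Sum>g\<in>{L<..n div k}. ?t g)"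
      unfolding pair_sum_def prod.case f_def P_def k_def
      by (simp only:) (rule sum.union_disjoint; auto)
    also have "(\<Sum>g\<in>{L<..n div k}. ?t g) = H n \<alpha> * real n ^ 3"
    proof -
      have "(\<Sum>g\<in>{L<..n div k}. ?t g) =
          (\<Sum>m\<in>{k..M}. pair_cov (1 - \<alpha>) a b m * (\<Sum>g\<in>{n div Suc m<..n div m}. f g))"
        unfolding L_def by (rule sum_by_div[OF k])
      also have "\<dots> = (\<Sum>m\<in>{k..M}. pair_cov (1 - \<alpha>) a b m * (tot_sum a b (n div m) - tot_sum a b (n div Suc m)))"
        unfolding f_def using k
        by (intro sum.cong refl arg_cong2[where f = "(*)"] tot_sum_diff div_le_mono2) auto
      finally show ?thesis
        using that by (simp add: H_def sum_distrib_right)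
    qed
    finally have eq: "pair_sum n \<alpha> (a, b) = (\<Sum>g\<in>{g\<in>{1..L}. P g}. ?t g) + H n \<alpha> * real n ^ 3" .
    have "n > 0" using that by simp
    have diff: "pair_sum n \<alpha> (a, b) / real n ^ 3 - H n \<alpha> = (\<Sum>g\<in>{g\<in>{1..L}. P g}. ?t g) / real n ^ 3"
      unfolding eq using \<open>n > 0\<close> by (simp add: add_divide_distrib)
    have nonneg: "0 \<le> ?t g" for g
      using pair_cov_bounds(1)[OF that(2)] by (simp add: f_def)
    have "(\<Sum>g\<in>{g\<in>{1..L}. P g}. ?t g) \<le> (\<Sum>g\<in>{1..L}. ?t g)"
      using nonneg by (intro sum_mono2) auto
    also have "\<dots> \<le> (\<Sum>g\<in>{1..L}. real k * (real L)\<^sup>2 * 1)"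
    proof (rule sum_mono)
      fix g assume "g \<in> {1..L}"
      then have "real k * (real g)\<^sup>2 \<le> real k * (real L)\<^sup>2"
        by (intro mult_left_mono power_mono) auto
      then have "f g \<le> real k * (real L)\<^sup>2"
        using totient_prod_le[of g a b] by (simp add: f_def k_def)
      then show "?t g \<le> real k * (real L)\<^sup>2 * 1"
        using pair_cov_bounds[OF that(2), of a b "n div g"] by (intro mult_mono) auto
    qed
    also have "\<dots> = real k * real L ^ 3" by (simp add: power2_eq_square power3_eq_cube)
    also have "\<dots> \<le> real k * (real n / real (Suc M)) ^ 3"
      unfolding L_def by (intro mult_left_mono power_mono of_nat_div_le_of_nat) auto
    also have "\<dots> = real k / real (Suc M) ^ 3 * real n ^ 3" by (simp add: power_divide)
    also have "\<dots> \<le> e * real n ^ 3" by (intro mult_right_mono M) simp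
    finally have "(\<Sum>g\<in>{g\<in>{1..L}. P g}. ?t g) / real n ^ 3 \<le> e"
      using \<open>n > 0\<close> by (simp add: divide_le_eq)
    moreover have "0 \<le> (\<Sum>g\<in>{g\<in>{1..L}. P g}. ?t g) / real n ^ 3"
      by (intro divide_nonneg_nonneg sum_nonneg nonneg) auto
    ultimately show ?thesis unfolding diff by simp
  qed
  ultimately show "\<exists>h. uniformly_convergent_on {0..1} h \<and> (\<forall>\<^sub>F n in sequentially.
      \<forall>\<alpha>\<in>{0..1}. \<bar>pair_sum n \<alpha> (a, b) / real n ^ 3 - h n \<alpha>\<bar> \<le> e)"
    by (intro exI[of _ H] conjI eventually_sequentiallyI[of "Suc M"] ballI)
qed

text \<open>Only the pairs with both entries up to \<open>K\<close> are kept. The others contribute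
  at most the difference of the squares of \<open>inv_squares n\<close> and
  \<open>inv_squares K\<close>, which is at most 4/K uniformly in \<alpha>.\<close>

lemma uniformly_convergent_VarX_B:
  "uniformly_convergent_on {0..1} (\<lambda>n \<alpha>. VarX_B n \<alpha> / real n ^ 3)"
proof (rule uniformly_convergent_on_approx)
  fix e :: real assume "e > 0"
  define K where "K = nat \<lceil>4 / e\<rceil> + 1"
  define H where "H n \<alpha> = (\<Sum>ab\<in>coprime_pairs K. pair_sum n \<alpha> ab / real n ^ 3)" for n \<alpha>
  have "K > 0" by (simp add: K_def)
  have "4 / e \<le> real K" unfolding K_def by linarith
  then have K: "4 / real K \<le> e" using \<open>e > 0\<close> \<open>K > 0\<close> by (simp add: field_simps)
  have "uniformly_convergent_on {0..1} H"
    unfolding H_def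
    by (rule uniformly_convergent_on_sum_finite)
       (auto simp: coprime_pairs_def intro!: uniformly_convergent_pair_sum)
  moreover have "\<bar>VarX_B n \<alpha> / real n ^ 3 - H n \<alpha>\<bar> \<le> e" if "n \<ge> K" "\<alpha> \<in> {0..1}" for n \<alpha>
  proof -
    let ?w = "\<lambda>(a, b). 1 / (real a)\<^sup>2 * (1 / (real b)\<^sup>2)"
    let ?R = "{1..n} \<times> {1..n} - {1..K} \<times> {1..K}"
    have "n > 0" using that \<open>K > 0\<close> by simp
    have sub: "coprime_pairs K \<subseteq> coprime_pairs n" using that by (auto simp: coprime_pairs_def)
    have "VarX_B n \<alpha> / real n ^ 3 - H n \<alpha> = (\<Sum>ab\<in>coprime_pairs n - coprime_pairs K. pair_sum n \<alpha> ab / real n ^ 3)"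
      unfolding VarX_B_eq_pair_sum H_def sum_divide_distrib
      using sum.subset_diff[OF sub, of "\<lambda>ab. pair_sum n \<alpha> ab / real n ^ 3"] by simp
    moreover have "0 \<le> \<dots>"
      by (intro sum_nonneg divide_nonneg_nonneg pair_sum_nonneg that) auto
    moreover have "(\<Sum>ab\<in>coprime_pairs n - coprime_pairs K. pair_sum n \<alpha> ab / real n ^ 3)
        \<le> (\<Sum>ab\<in>coprime_pairs n - coprime_pairs K. ?w ab)"
    proof (rule sum_mono)
      fix ab assume "ab \<in> coprime_pairs n - coprime_pairs K"
      then obtain a b where ab: "ab = (a, b)" "0 < a" "0 < b" by (auto simp: coprime_pairs_def)
      have "pair_sum n \<alpha> (a, b) \<le> \<alpha> * real n ^ 3 * ?w (a, b)"
        using pair_sum_le[OF that(2) ab(2,3)] by simp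
      also have "\<dots> \<le> 1 * real n ^ 3 * ?w (a, b)"
        using that by (intro mult_right_mono) auto
      finally show "pair_sum n \<alpha> ab / real n ^ 3 \<le> ?w ab"
        using \<open>n > 0\<close> by (simp add: ab divide_le_eq mult.commute)
    qed
    moreover have "\<dots> \<le> (\<Sum>ab\<in>?R. ?w ab)"
      by (rule sum_mono2) (auto simp: coprime_pairs_def)
    moreover have "(\<Sum>ab\<in>?R. ?w ab) = (inv_squares n)\<^sup>2 - (inv_squares K)\<^sup>2"
      unfolding sum_pairs_inv_squares [symmetric]
      using that by (intro sum_diff) auto
    moreover have "\<dots> \<le> e"
    proof -
      have "(inv_squares n)\<^sup>2 - (inv_squares K)\<^sup>2
          = (inv_squares n - inv_squares K) * (inv_squares n + inv_squares K)"
        by (simp add: power2_eq_square algebra_simps)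
      also have "\<dots> \<le> 1 / real K * 4"
        using inv_squares_bounds[of n] inv_squares_bounds[of K] inv_squares_diff[OF \<open>K > 0\<close> that(1)]
        by (intro mult_mono) auto
      finally show ?thesis using K by simp
    qed
    ultimately show ?thesis by linarith
  qed
  ultimately show "\<exists>h. uniformly_convergent_on {0..1} h \<and> (\<forall>\<^sub>F n in sequentially.
      \<forall>\<alpha>\<in>{0..1}. \<bar>VarX_B n \<alpha> / real n ^ 3 - h n \<alpha>\<bar> \<le> e)"
    by (intro exI[of _ H] conjI eventually_sequentiallyI[of K] ballI)
qed

section \<open>Positivity of the limit\<close>

lemma VarX_B_ge:
  assumes "\<alpha> \<in> {0..1}" "n \<ge> 2"
  shows "\<alpha> * (1 - \<alpha>) * (tot_sum 1 1 n - tot_sum 1 1 (n div 2)) \<le> VarX_B n \<alpha>"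
proof -
  let ?t = "\<lambda>d e. real (totient d) * real (totient e) * cov (1 - \<alpha>) n d e"
  have nonneg: "0 \<le> ?t d e" if "d \<ge> 2" "e \<ge> 2" for d e
    using cov_nonneg[OF assms(1), of d e n] that by simp
  \<comment> \<open>For d > n/2 the only multiple of \<open>d\<close> up to \<open>n\<close> is
    \<open>d\<close> itself, so this is the variance of a single inclusion. All other terms are
    nonnegative and are discarded.\<close>
  have "cov (1 - \<alpha>) n d d = \<alpha> * (1 - \<alpha>)" if "d \<in> {n div 2<..n}" for d
  proof -
    have "n div d = 1" using that div_eq_if_between[of d n 1] by (simp add: numeral_2_eq_2)
    then show ?thesis by (simp add: cov_def power2_eq_square algebra_simps)
  qed
  then have "\<alpha> * (1 - \<alpha>) * (tot_sum 1 1 n - tot_sum 1 1 (n div 2)) = (\<Sum>d\<in>{n div 2<..n}. ?t d d)"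
    by (simp add: sum_distrib_left mult_ac flip: tot_sum_diff)
  also have "\<dots> \<le> (\<Sum>d\<in>{2..n}. ?t d d)"
    using assms nonneg by (intro sum_mono2) auto
  also have "\<dots> \<le> (\<Sum>d\<in>{2..n}. \<Sum>e\<in>{2..n}. ?t d e)"
    using nonneg by (intro sum_mono member_le_sum) auto
  finally show ?thesis by (simp add: VarX_B_eq)
qed

text \<open>Halving the argument divides the limit of the totient sum by 8, so the lower bound tends
  to \<alpha> (1 - \<alpha>) 7c/8 with c \<ge> 1/4096.\<close>

lemma lim_VarX_B_pos:
  assumes "0 < \<alpha>" "\<alpha> < 1" and lim: "(\<lambda>n. VarX_B n \<alpha> / real n ^ 3) \<longlonglongrightarrow> v"
  shows "v > 0"
proof -
  obtain c where c: "(\<lambda>N. tot_sum 1 1 N / real N ^ 3) \<longlonglongrightarrow> c"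
    using convergent_tot_sum[of 1 1] by (auto simp: convergent_def)
  have "1 / 4096 \<le> tot_sum 1 1 N / real N ^ 3" if "N \<ge> 1" for N
    using tot_sum_1_1_ge[of N] that by (simp add: field_simps)
  then have "1 / 4096 \<le> c"
    by (intro tendsto_lowerbound[OF c] eventually_sequentiallyI[of 1]) auto
  have "(\<lambda>n. \<alpha> * (1 - \<alpha>) * (tot_sum 1 1 n / real n ^ 3 - tot_sum 1 1 (n div 2) / real n ^ 3))
      \<longlonglongrightarrow> \<alpha> * (1 - \<alpha>) * (c - c * (1 / real 2) ^ 3)"
    by (intro tendsto_intros c tot_sum_div_tendsto) simp
  moreover have "\<alpha> * (1 - \<alpha>) * (tot_sum 1 1 n / real n ^ 3 - tot_sum 1 1 (n div 2) / real n ^ 3)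
      \<le> VarX_B n \<alpha> / real n ^ 3" if "n \<ge> 2" for n
    using divide_right_mono[OF VarX_B_ge[of \<alpha> n], of "real n ^ 3"] assms that
    by (simp flip: diff_divide_distrib)
  ultimately have "\<alpha> * (1 - \<alpha>) * (c - c * (1 / real 2) ^ 3) \<le> v"
    by (intro tendsto_le[OF _ lim] eventually_sequentiallyI[of 2]) auto
  moreover have "c - c * (1 / real 2) ^ 3 > 0"
    using \<open>1 / 4096 \<le> c\<close> by (simp add: power3_eq_cube)
  ultimately show ?thesis
    using assms by (meson diff_gt_0_iff_gt less_le_trans mult_pos_pos)
qed

theorem theorem1p3:
  shows "(\<exists>v :: real \<Rightarrow> real. (\<forall>\<alpha>\<in>{0<..<1}. v \<alpha> > 0) \<and>
           (\<forall>\<epsilon>>0. \<exists>M>0. \<forall>(n::nat) \<alpha>. n \<ge> 3 \<longrightarrow> \<alpha> \<in> {0<..<1} \<longrightarrow>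
              \<alpha> * real n / ((ln (real n))^3 * ln (ln (real n))) \<ge> M \<longrightarrow>
              \<bar>VarX_B n \<alpha> / real n ^ 3 - v \<alpha>\<bar> \<le> \<epsilon>))
       \<and> (\<exists>C>0. \<forall>(n::nat) (\<alpha>::real). n \<ge> 1 \<longrightarrow> \<alpha> \<in> {0..1} \<longrightarrow>
              VarX_B n \<alpha> \<le> C * \<alpha> * real n ^ 3)"
proof (intro conjI)
  obtain v where v: "uniform_limit {0..1} (\<lambda>n \<alpha>. VarX_B n \<alpha> / real n ^ 3) v sequentially"
    using uniformly_convergent_VarX_B by (auto simp: uniformly_convergent_on_def)
  have "v \<alpha> > 0" if "\<alpha> \<in> {0<..<1}" for \<alpha>
    by (rule lim_VarX_B_pos[of \<alpha>]) (use that in \<open>auto intro: tendsto_uniform_limitI[OF v]\<close>)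
  moreover have "\<exists>M>0. \<forall>(n::nat) \<alpha>. n \<ge> 3 \<longrightarrow> \<alpha> \<in> {0<..<1} \<longrightarrow>
      \<alpha> * real n / ((ln (real n))^3 * ln (ln (real n))) \<ge> M \<longrightarrow>
      \<bar>VarX_B n \<alpha> / real n ^ 3 - v \<alpha>\<bar> \<le> \<epsilon>" if "\<epsilon> > 0" for \<epsilon>
  proof -
    obtain N where N: "\<And>n \<alpha>. n \<ge> N \<Longrightarrow> \<alpha> \<in> {0..1} \<Longrightarrow> \<bar>VarX_B n \<alpha> / real n ^ 3 - v \<alpha>\<bar> < \<epsilon>"
      using v \<open>\<epsilon> > 0\<close> unfolding uniform_limit_sequentially_iff dist_real_def by metis
    define q where "q n = real n / ((ln (real n))^3 * ln (ln (real n)))" for n :: nat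
    \<comment> \<open>\<open>M\<close> exceeds every \<open>q n\<close> with 3 \<le> n \<le> N.
      Since \<alpha> < 1, the growth hypothesis is contradictory for n < N, and for n \<ge> N
      uniform convergence suffices.\<close>
    define M where "M = 1 + (\<Sum>n\<in>{3..N}. q n)"
    have q: "q n \<ge> 0" if "n \<ge> 3" for n
    proof -
      \<comment> \<open>Since e \<le> 3 \<le> n, ln n is at least 1 and ln (ln n) is nonnegative; at
        most it is 0, where the quotient is 0 by convention.\<close>
      have "exp 1 \<le> real n" using exp_le that by linarith
      then have "ln (real n) \<ge> 1" using that by (simp add: ln_ge_iff)
      then show ?thesis by (simp add: q_def)
    qed
    have "M > 0" unfolding M_def using q by (intro add_pos_nonneg sum_nonneg) auto
    moreover have "\<bar>VarX_B n \<alpha> / real n ^ 3 - v \<alpha>\<bar> \<le> \<epsilon>"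
      if n: "n \<ge> 3" "\<alpha> \<in> {0<..<1}" "\<alpha> * real n / ((ln (real n))^3 * ln (ln (real n))) \<ge> M" for n \<alpha>
    proof (cases "n \<ge> N")
      case True
      then show ?thesis using N[of n \<alpha>] n(2) by force
    next
      case False
      have "M \<le> \<alpha> * q n" using n(3) by (simp add: q_def)
      also have "\<dots> \<le> 1 * q n" using n q by (intro mult_right_mono) auto
      also have "q n \<le> (\<Sum>n\<in>{3..N}. q n)"
        using n False q by (intro member_le_sum) auto
      finally show ?thesis by (simp add: M_def)
    qed
    ultimately show ?thesis by blast
  qed
  ultimately show "\<exists>v :: real \<Rightarrow> real. (\<forall>\<alpha>\<in>{0<..<1}. v \<alpha> > 0) \<and>
           (\<forall>\<epsilon>>0. \<exists>M>0. \<forall>(n::nat) \<alpha>. n \<ge> 3 \<longrightarrow> \<alpha> \<in> {0<..<1} \<longrightarrow>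
              \<alpha> * real n / ((ln (real n))^3 * ln (ln (real n))) \<ge> M \<longrightarrow>
              \<bar>VarX_B n \<alpha> / real n ^ 3 - v \<alpha>\<bar> \<le> \<epsilon>)"
    by blast
  show "\<exists>C>0. \<forall>(n::nat) (\<alpha>::real). n \<ge> 1 \<longrightarrow> \<alpha> \<in> {0..1} \<longrightarrow> VarX_B n \<alpha> \<le> C * \<alpha> * real n ^ 3"
    using VarX_B_le by (intro exI[of _ 4]) simp
qed

end
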